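(* Let $U,V$ be complex vector spaces of dimensions $m$ and $n$, and fix $r\ge1$. Let $X$ be the Segre-Veronese variety of $\mathbb{P}(U^* )\times\mathbb{P}(V^* )$ in $\mathbb{P}(U^*\otimes S^2V^* )$ (embedded by $\mathcal{O}(1,2)$), and let $c$ be the vector defined by $c_j=r\binom{m-1}{j}$ for $0\le j\le m-1$. Then $\sigma_r(X)\subseteq\Sigma_{\kappa\le c}$.
   Context: $\sigma_r(X)$ is the $r$th secant variety of $X$: the Zariski closure of the set of $[x]$ with $x=\sum_{i=1}^ru_i\otimes v_i\otimes v_i$, $u_i\in U^*$, $v_i\in V^*$. For $x\in U^*\otimes S^2V^*\subset U^*\otimes V^*\otimes V^*$ and $0\le j\le m-1$, $\psi_{j,x}\colon V\otimes\bigwedge^jU^*\to V^*\otimes\bigwedge^{j+1}U^*$ is the linear map obtained by restricting to $U^*\otimes S^2V^*$ the linear assignment which for $x=u\otimes v^*\otimes w^*$ is $\psi_{j,x}(v\otimes\omega)=v^*(v)\,w^*\otimes(u\wedge\omega)$. In bases, it is a matrix of linear forms in $S^\bullet(U\otimes S^2V)$, the polynomial ring on $U^*\otimes S^2V^*$. If $m=2j+1$ with $j$ odd, then in appropriate coordinates (identifying $\bigwedge^{j+1}U^*$ with the dual of $\bigwedge^jU^*$ up to the one-dimensional space $\bigwedge^mU^*$) the matrix of $\psi_{j,x}$ is skew-symmetric. For a vector $c=(c_0,\dots,c_{m-1})$ of positive integers, $I_{\kappa_j\le c_j}\subseteq S^\bullet(U\otimes S^2V)$ is the ideal generated by the $(c_j+2)\times(c_j+2)$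 principal Pfaffians of the skew-symmetric matrix $\psi_{j,x}$ if $j=(m-1)/2$, $j$ is odd, and $c_j$ is even; otherwise it is the ideal generated by the $(c_j+1)\times(c_j+1)$ minors of $\psi_{j,x}$. $I_{\kappa\le c}$ is the ideal generated by all $I_{\kappa_j\le c_j}$, and $\Sigma_{\kappa\le c}$ is the subscheme of $\mathbb{P}(U^*\otimes S^2V^* )$ it defines. *)

theory Defs
  imports
    "Jordan_Normal_Form.Determinant"
    "HOL-Algebra.Ideal"
    "HOL-Library.Poly_Mapping"
begin

section \<open>The polynomial ring on \<open>U\<^sup>* \<otimes> S\<^sup>2V\<^sup>*\<close>\<close>

text \<open>
  For \<open>dim U = m\<close> and \<open>dim V = n\<close>, the symmetric algebra of \<open>U \<otimes> S\<^sup>2V\<close> is the polynomial ring in the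
  coordinates \<open>x(e\<^sub>i, f\<^sub>a, f\<^sub>b)\<close>, \<open>a \<le> b\<close>, of a tensor \<open>x\<close>. Here \<open>var \<Rightarrow>\<^sub>0 nat\<close> are the monomials.
\<close>

type_synonym var = "nat \<times> nat \<times> nat"
type_synonym cpoly = "(var \<Rightarrow>\<^sub>0 nat) \<Rightarrow>\<^sub>0 complex"

definition coord_vars :: "nat \<Rightarrow> nat \<Rightarrow> var set" where
  "coord_vars m n = {(i, a, b). i < m \<and> a \<le> b \<and> b < n}"

definition coord_ring :: "nat \<Rightarrow> nat \<Rightarrow> cpoly ring" where
  "coord_ring m n =
    \<lparr>carrier = {p. \<forall>t\<in>Poly_Mapping.keys p. Poly_Mapping.keys t \<subseteq> coord_vars m n},
     mult = (*), one = 1, zero = 0, add = (+)\<rparr>"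

lemma cring_coord_ring: "cring (coord_ring m n)"
proof -
  let ?C = "{p :: cpoly. \<forall>t\<in>Poly_Mapping.keys p. Poly_Mapping.keys t \<subseteq> coord_vars m n}"
  have add: "p + q \<in> ?C" if "p \<in> ?C" "q \<in> ?C" for p q
    using that Poly_Mapping.keys_add[of p q] by blast
  have neg: "- p \<in> ?C" if "p \<in> ?C" for p
    using that by simp
  have mult: "p * q \<in> ?C" if p: "p \<in> ?C" and q: "q \<in> ?C" for p q
  proof (intro CollectI ballI)
    fix t assume "t \<in> Poly_Mapping.keys (p * q)"
    then obtain a b where "t = a + b" "a \<in> Poly_Mapping.keys p" "b \<in> Poly_Mapping.keys q"
      using keys_mult[of p q] by blast
    then show "Poly_Mapping.keys t \<subseteq> coord_vars m n"
      using p q Poly_Mapping.keys_add[of a b] by blast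
  qed
  have zero: "0 \<in> ?C" and one: "1 \<in> ?C"
    by simp_all
  have "abelian_group (coord_ring m n)"
  proof (rule abelian_groupI, unfold coord_ring_def partial_object.simps monoid.simps ring.simps)
    fix p assume p: "p \<in> ?C"
    show "\<exists>q\<in>?C. q + p = 0"
      using neg[OF p] by (intro bexI[of _ "- p"]) (simp_all only: left_minus)
  qed (assumption | rule add zero add.assoc add.commute add_0_left)+
  moreover have "Group.comm_monoid (coord_ring m n)"
    by (rule comm_monoidI, unfold coord_ring_def partial_object.simps monoid.simps)
       (assumption | rule mult one mult.assoc mult.commute mult_1_left)+
  ultimately show ?thesis
    by (rule cringI, unfold coord_ring_def partial_object.simps monoid.simps ring.simps)
       (rule distrib_right)
qed

definition mono_degree :: "(var \<Rightarrow>\<^sub>0 nat) \<Rightarrow> nat" where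
  "mono_degree t = (\<Sum>v\<in>Poly_Mapping.keys t. Poly_Mapping.lookup t v)"

definition homogeneous :: "cpoly \<Rightarrow> bool" where
  "homogeneous p \<longleftrightarrow> (\<exists>d. \<forall>t\<in>Poly_Mapping.keys p. mono_degree t = d)"

definition poly_eval :: "cpoly \<Rightarrow> (var \<Rightarrow> complex) \<Rightarrow> complex" where
  "poly_eval p x =
    (\<Sum>t\<in>Poly_Mapping.keys p. Poly_Mapping.lookup p t *
       (\<Prod>v\<in>Poly_Mapping.keys t. x v ^ Poly_Mapping.lookup t v))"

text \<open>
  A closed subscheme of \<open>\<P>(U\<^sup>* \<otimes> S\<^sup>2V\<^sup>*)\<close> is given by a homogeneous ideal, and two ideals give the same
  subscheme iff their saturations with respect to the irrelevant ideal agree. The subscheme of \<open>I\<close> is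
  contained in the subscheme of \<open>J\<close> iff the saturation of \<open>J\<close> is contained in that of \<open>I\<close>.
\<close>

definition saturation :: "nat \<Rightarrow> nat \<Rightarrow> cpoly set \<Rightarrow> cpoly set" where
  "saturation m n I =
    {p \<in> carrier (coord_ring m n).
       \<exists>N. \<forall>t. Poly_Mapping.keys t \<subseteq> coord_vars m n \<and> mono_degree t = N \<longrightarrow>
         Poly_Mapping.single t 1 * p \<in> I}"

definition subscheme_contained :: "nat \<Rightarrow> nat \<Rightarrow> cpoly set \<Rightarrow> cpoly set \<Rightarrow> bool" where
  "subscheme_contained m n I J \<longleftrightarrow> saturation m n J \<subseteq> saturation m n I"


section \<open>Minors and Pfaffians\<close>

text \<open>
  Matrices are functions of row and column labels; the lists \<open>R\<close> and \<open>C\<close> enumerate the labels, and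
  \<^const>\<open>subseqs\<close> selects sublists, keeping the order.
\<close>

definition minors :: "nat \<Rightarrow> 'r list \<Rightarrow> 'c list \<Rightarrow> ('r \<Rightarrow> 'c \<Rightarrow> cpoly) \<Rightarrow> cpoly set" where
  "minors k R C M =
    {det (mat k k (\<lambda>(p, q). M (rs ! p) (cs ! q))) | rs cs.
       rs \<in> set (subseqs R) \<and> length rs = k \<and> cs \<in> set (subseqs C) \<and> length cs = k}"

text \<open>The Pfaffian of a skew-symmetric \<open>2k \<times> 2k\<close> matrix.\<close>

definition pfaffian :: "nat \<Rightarrow> (nat \<Rightarrow> nat \<Rightarrow> cpoly) \<Rightarrow> cpoly" where
  "pfaffian k A =
    Poly_Mapping.single 0 (1 / (2 ^ k * fact k)) *
    (\<Sum>\<sigma> | \<sigma> permutes {..<2 * k}. of_int (sign \<sigma>) * (\<Prod>i<k. A (\<sigma> (2 * i)) (\<sigma> (2 * i + 1))))"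

definition principal_pfaffians :: "nat \<Rightarrow> 'r list \<Rightarrow> ('r \<Rightarrow> 'r \<Rightarrow> cpoly) \<Rightarrow> cpoly set" where
  "principal_pfaffians k R K =
    {pfaffian (k div 2) (\<lambda>p q. K (rs ! p) (rs ! q)) | rs. rs \<in> set (subseqs R) \<and> length rs = k}"


section \<open>Exterior algebra of \<open>U\<^sup>*\<close> and the maps \<open>\<psi>\<close>\<close>

text \<open>
  An element of the \<open>j\<close>-th exterior power of \<open>U\<^sup>*\<close> is an alternating \<open>j\<close>-linear form on \<open>U\<close>, given as
  a function of the list of its \<open>j\<close> arguments that vanishes on lists of other lengths. Likewise elements
  of \<open>V \<otimes> \<Lambda>\<^sup>jU\<^sup>*\<close> are \<open>V\<close>-valued alternating forms, \<open>v \<otimes> \<omega>\<close> being \<open>\<lambda>l. \<omega> l \<cdot> v\<close>, and elements of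
  \<open>V\<^sup>* \<otimes> \<Lambda>\<^sup>jU\<^sup>*\<close> are functions of a vector in \<open>V\<close> and a list of vectors in \<open>U\<close>.
  The list \<open>nths l (- {i})\<close> is \<open>l\<close> without its entry at position \<open>i\<close>.
\<close>

definition wedge :: "('u \<Rightarrow> complex) \<Rightarrow> ('u list \<Rightarrow> complex) \<Rightarrow> 'u list \<Rightarrow> complex" where
  "wedge u \<omega> l = (\<Sum>i<length l. (-1) ^ i * u (l ! i) * \<omega> (nths l (- {i})))"

definition unit_form :: "'u list \<Rightarrow> complex" where
  "unit_form l = (if l = [] then 1 else 0)"

definition tensor :: "('u \<Rightarrow> complex) \<Rightarrow> ('v \<Rightarrow> complex) \<Rightarrow> ('v \<Rightarrow> complex) \<Rightarrow> 'u \<Rightarrow> 'v \<Rightarrow> 'v \<Rightarrow> complex"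
  where "tensor u v w = (\<lambda>p q s. u p * v q * w s)"

text \<open>
  \<open>\<psi>\<^sub>j\<^sub>,\<^sub>x\<close>, for every \<open>j\<close> at once: contraction of the second factor of \<open>x\<close> with \<open>V\<close>, and exterior
  product of the first factor with the form. Lemma \<open>psi_tensor\<close> below is the defining property.
\<close>

definition psi :: "('u \<Rightarrow> 'v \<Rightarrow> 'v \<Rightarrow> complex) \<Rightarrow> ('u list \<Rightarrow> 'v) \<Rightarrow> 'v \<Rightarrow> 'u list \<Rightarrow> complex" where
  "psi x \<eta> s l = (\<Sum>i<length l. (-1) ^ i * x (l ! i) (\<eta> (nths l (- {i}))) s)"

lemma psi_tensor:
  assumes "Vector_Spaces.linear scale (*) v"
  shows "psi (tensor u v w) (\<lambda>l. scale (\<omega> l) y) = (\<lambda>s l. v y * w s * wedge u \<omega> l)"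
proof -
  interpret v: Vector_Spaces.linear scale "(*)" v by fact
  show ?thesis
    unfolding psi_def tensor_def wedge_def v.scale sum_distrib_left
    by (intro ext sum.cong refl) (simp only: ac_simps)
qed

text \<open>Labels of the basis \<open>e\<^sub>S\<close> of the \<open>j\<close>-th exterior power: increasing lists of \<open>j\<close> numbers below \<open>m\<close>.\<close>

definition ext_labels :: "nat \<Rightarrow> nat \<Rightarrow> nat list list" where
  "ext_labels m j = filter (\<lambda>S. length S = j) (subseqs [0..<m])"

definition psi_labels :: "nat \<Rightarrow> nat \<Rightarrow> nat \<Rightarrow> (nat \<times> nat list) list" where
  "psi_labels m n j = List.product [0..<n] (ext_labels m j)"


section \<open>Complex vector spaces with ordered bases\<close>

locale based_spaces =
  U: finite_dimensional_vector_space scaleU "set us" +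
  V: finite_dimensional_vector_space scaleV "set vs"
  for scaleU :: "complex \<Rightarrow> 'u::ab_group_add \<Rightarrow> 'u" and us :: "'u list"
    and scaleV :: "complex \<Rightarrow> 'v::ab_group_add \<Rightarrow> 'v" and vs :: "'v list" +
  assumes distinct_us: "distinct us" and distinct_vs: "distinct vs"
begin

definition U_dual :: "('u \<Rightarrow> complex) set" where
  "U_dual = {u. Vector_Spaces.linear scaleU (*) u}"

definition V_dual :: "('v \<Rightarrow> complex) set" where
  "V_dual = {v. Vector_Spaces.linear scaleV (*) v}"

text \<open>The tensors in \<open>U\<^sup>* \<otimes> S\<^sup>2V\<^sup>*\<close>, as trilinear forms.\<close>

definition sym_tensors :: "('u \<Rightarrow> 'v \<Rightarrow> 'v \<Rightarrow> complex) set" where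
  "sym_tensors =
    {x. (\<forall>q s. (\<lambda>p. x p q s) \<in> U_dual) \<and> (\<forall>p s. (\<lambda>q. x p q s) \<in> V_dual) \<and>
        (\<forall>p q s. x p q s = x p s q)}"


subsection \<open>Projective space and secant varieties\<close>

definition line :: "('u \<Rightarrow> 'v \<Rightarrow> 'v \<Rightarrow> complex) \<Rightarrow> ('u \<Rightarrow> 'v \<Rightarrow> 'v \<Rightarrow> complex) set" where
  "line x = range (\<lambda>c p q s. c * x p q s)"

definition proj_space :: "('u \<Rightarrow> 'v \<Rightarrow> 'v \<Rightarrow> complex) set set" where
  "proj_space = line ` (sym_tensors - {\<lambda>_ _ _. 0})"

definition coords :: "('u \<Rightarrow> 'v \<Rightarrow> 'v \<Rightarrow> complex) \<Rightarrow> var \<Rightarrow> complex" where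
  "coords x = (\<lambda>(i, a, b). x (us ! i) (vs ! a) (vs ! b))"

definition vanishes_at :: "cpoly \<Rightarrow> ('u \<Rightarrow> 'v \<Rightarrow> 'v \<Rightarrow> complex) set \<Rightarrow> bool" where
  "vanishes_at f P \<longleftrightarrow> (\<forall>x \<in> P - {\<lambda>_ _ _. 0}. poly_eval f (coords x) = 0)"

definition hom_vanishing :: "('u \<Rightarrow> 'v \<Rightarrow> 'v \<Rightarrow> complex) set set \<Rightarrow> cpoly set" where
  "hom_vanishing Z =
    {f \<in> carrier (coord_ring (length us) (length vs)). homogeneous f \<and> (\<forall>P\<in>Z. vanishes_at f P)}"

definition zariski_closure ::
    "('u \<Rightarrow> 'v \<Rightarrow> 'v \<Rightarrow> complex) set set \<Rightarrow> ('u \<Rightarrow> 'v \<Rightarrow> 'v \<Rightarrow> complex) set set" where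
  "zariski_closure Z = {P \<in> proj_space. \<forall>f\<in>hom_vanishing Z. vanishes_at f P}"

text \<open>The homogeneous ideal of \<open>Z\<close>; it defines the reduced subscheme structure on a closed \<open>Z\<close>.\<close>

definition vanishing_ideal :: "('u \<Rightarrow> 'v \<Rightarrow> 'v \<Rightarrow> complex) set set \<Rightarrow> cpoly set" where
  "vanishing_ideal Z = Idl\<^bsub>coord_ring (length us) (length vs)\<^esub> (hom_vanishing Z)"

definition segre_veronese :: "('u \<Rightarrow> 'v \<Rightarrow> 'v \<Rightarrow> complex) set set" where
  "segre_veronese =
    {line (tensor u v v) | u v. u \<in> U_dual - {\<lambda>_. 0} \<and> v \<in> V_dual - {\<lambda>_. 0}}"

definition affine_cone ::
    "('u \<Rightarrow> 'v \<Rightarrow> 'v \<Rightarrow> complex) set set \<Rightarrow> ('u \<Rightarrow> 'v \<Rightarrow> 'v \<Rightarrow> complex) set" where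
  "affine_cone Z = insert (\<lambda>_ _ _. 0) (\<Union>Z)"

definition secant_variety ::
    "nat \<Rightarrow> ('u \<Rightarrow> 'v \<Rightarrow> 'v \<Rightarrow> complex) set set \<Rightarrow> ('u \<Rightarrow> 'v \<Rightarrow> 'v \<Rightarrow> complex) set set" where
  "secant_variety r Z =
    zariski_closure
      {line x | x y. x \<noteq> (\<lambda>_ _ _. 0) \<and> (\<forall>i<r. y i \<in> affine_cone Z) \<and>
        x = (\<lambda>p q s. \<Sum>i<r. y i p q s)}"

text \<open>Hence the sums in the secant variety of \<open>segre_veronese\<close> are those of the tensors \<open>u\<^sub>i \<otimes> v\<^sub>i \<otimes> v\<^sub>i\<close>.\<close>

lemma affine_cone_segre_veronese:
  "affine_cone segre_veronese = {tensor u v v | u v. u \<in> U_dual \<and> v \<in> V_dual}"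
proof -
  interpret C: vector_space "(*) :: complex \<Rightarrow> complex \<Rightarrow> complex"
    by unfold_locales (rule distrib_left distrib_right mult.assoc[symmetric] mult_1_left)+
  have zero: "(\<lambda>_. 0) \<in> U_dual" "(\<lambda>_. 0) \<in> V_dual"
    by (simp_all add: U_dual_def V_dual_def Vector_Spaces.linear_iff
        U.vector_space_axioms V.vector_space_axioms C.vector_space_axioms)
  have scale: "(\<lambda>p. c * u p) \<in> U_dual" if "u \<in> U_dual" for c u
    using that by (simp add: U_dual_def Vector_Spaces.linear_iff distrib_left mult.left_commute)
  have cone: "tensor u v v \<in> {tensor u v v | u v. u \<in> U_dual \<and> v \<in> V_dual}"
    if "u \<in> U_dual" "v \<in> V_dual" for u v
    using that by (intro CollectI exI[of _ u] exI[of _ v]) simp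
  show ?thesis
  proof (intro equalityI subsetI)
    fix x assume "x \<in> affine_cone segre_veronese"
    then consider "x = (\<lambda>_ _ _. 0)" | L where "L \<in> segre_veronese" "x \<in> L"
      unfolding affine_cone_def by (elim insertE UnionE)
    then show "x \<in> {tensor u v v | u v. u \<in> U_dual \<and> v \<in> V_dual}"
    proof cases
      case 1
      have "x = tensor (\<lambda>_. 0) (\<lambda>_. 0) (\<lambda>_. 0)"
        unfolding 1 tensor_def by simp
      with cone[OF zero] show ?thesis by simp
    next
      case 2
      from 2(1) obtain u v where L: "L = line (tensor u v v)"
        and uv: "u \<in> U_dual" "v \<in> V_dual"
        unfolding segre_veronese_def by (elim CollectE exE conjE DiffE)
      from 2(2) obtain c where x: "x = (\<lambda>p q s. c * tensor u v v p q s)"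
        unfolding L line_def by (elim rangeE)
      have "x = tensor (\<lambda>p. c * u p) v v"
        unfolding x tensor_def by (simp only: mult.assoc)
      with cone[OF scale[OF uv(1)] uv(2)] show ?thesis by (simp only:)
    qed
  next
    fix x assume "x \<in> {tensor u v v | u v. u \<in> U_dual \<and> v \<in> V_dual}"
    then obtain u v where x: "x = tensor u v v" and uv: "u \<in> U_dual" "v \<in> V_dual"
      by (elim CollectE exE conjE)
    show "x \<in> affine_cone segre_veronese"
    proof (cases "u = (\<lambda>_. 0) \<or> v = (\<lambda>_. 0)")
      case True
      then have "x = (\<lambda>_ _ _. 0)"
        unfolding x tensor_def by (elim disjE) simp_all
      then show ?thesis by (simp add: affine_cone_def)
    next
      case False
      have "x \<in> line x"
        unfolding line_def by (rule range_eqI[of _ _ 1]) simp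
      moreover have "line x \<in> segre_veronese"
        unfolding segre_veronese_def x using uv False
        by (intro CollectI exI[of _ u] exI[of _ v]) simp
      ultimately show ?thesis
        unfolding affine_cone_def by (intro insertI2 UnionI)
    qed
  qed
qed


subsection \<open>The matrices of linear forms\<close>

definition dual_basis_U :: "nat \<Rightarrow> 'u \<Rightarrow> complex" where
  "dual_basis_U i p = U.representation (set us) p (us ! i)"

definition dual_basis_V :: "nat \<Rightarrow> 'v \<Rightarrow> complex" where
  "dual_basis_V a q = V.representation (set vs) q (vs ! a)"

text \<open>The basis of \<^const>\<open>sym_tensors\<close> dual to the coordinates \<^const>\<open>coords\<close> with \<open>a \<le> b\<close>.\<close>

definition tensor_basis :: "var \<Rightarrow> 'u \<Rightarrow> 'v \<Rightarrow> 'v \<Rightarrow> complex" where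
  "tensor_basis = (\<lambda>(i, a, b) p q s.
     tensor (dual_basis_U i) (dual_basis_V a) (dual_basis_V b) p q s +
     (if a = b then 0 else tensor (dual_basis_U i) (dual_basis_V b) (dual_basis_V a) p q s))"

text \<open>The linear form \<open>\<phi>\<close> on \<^const>\<open>sym_tensors\<close> as an element of the polynomial ring.\<close>

definition linear_form :: "(('u \<Rightarrow> 'v \<Rightarrow> 'v \<Rightarrow> complex) \<Rightarrow> complex) \<Rightarrow> cpoly" where
  "linear_form \<phi> =
    (\<Sum>t\<in>coord_vars (length us) (length vs).
       Poly_Mapping.single (Poly_Mapping.single t 1) (\<phi> (tensor_basis t)))"

text \<open>\<open>wedge_list S \<omega>\<close> is \<open>e\<^sub>s\<^sub>1 \<and> \<dots> \<and> e\<^sub>s\<^sub>j \<and> \<omega>\<close> for \<open>S = [s\<^sub>1, \<dots>, s\<^sub>j]\<close>, with \<open>e\<^sub>i\<close> the basis of \<open>U\<^sup>*\<close> dual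
  to \<^term>\<open>us\<close>.\<close>

definition wedge_list :: "nat list \<Rightarrow> ('u list \<Rightarrow> complex) \<Rightarrow> 'u list \<Rightarrow> complex" where
  "wedge_list S \<omega> = foldr (\<lambda>i. wedge (dual_basis_U i)) S \<omega>"

definition domain_basis :: "nat \<times> nat list \<Rightarrow> 'u list \<Rightarrow> 'v" where
  "domain_basis = (\<lambda>(a, S) l. scaleV (wedge_list S unit_form l) (vs ! a))"

text \<open>
  The coefficient of a form at a basis element \<open>e\<^sub>T\<close> is its value on the basis vectors of \<open>U\<close> with
  indices \<open>T\<close>.
\<close>

definition psi_matrix :: "nat \<times> nat list \<Rightarrow> nat \<times> nat list \<Rightarrow> cpoly" where
  "psi_matrix = (\<lambda>(b, T) col. linear_form (\<lambda>x. psi x (domain_basis col) (vs ! b) (map ((!) us) T)))"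

text \<open>
  If \<open>m = 2j + 1\<close>, the form \<open>\<theta>\<close> of degree \<open>j + 1\<close> is identified with the functional \<open>\<omega> \<mapsto> \<omega> \<and> \<theta>\<close> on
  forms of degree \<open>j\<close>, where a form of degree \<open>m\<close> is identified with its value on \<^term>\<open>us\<close>. In the
  dual of the basis \<open>e\<^sub>S\<close>, this gives the square matrix that is skew-symmetric for odd \<open>j\<close>.
\<close>

definition psi_skew_matrix :: "nat \<times> nat list \<Rightarrow> nat \<times> nat list \<Rightarrow> cpoly" where
  "psi_skew_matrix =
    (\<lambda>(b, S) col. linear_form (\<lambda>x. wedge_list S (psi x (domain_basis col) (vs ! b)) us))"


subsection \<open>The ideals\<close>

definition kappa_generators :: "(nat \<Rightarrow> nat) \<Rightarrow> nat \<Rightarrow> cpoly set" where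
  "kappa_generators c j =
    (let m = length us; n = length vs in
     if m = 2 * j + 1 \<and> odd j \<and> even (c j)
     then principal_pfaffians (c j + 2) (psi_labels m n j) psi_skew_matrix
     else minors (c j + 1) (psi_labels m n (j + 1)) (psi_labels m n j) psi_matrix)"

definition I_kappa_at :: "(nat \<Rightarrow> nat) \<Rightarrow> nat \<Rightarrow> cpoly set" where
  "I_kappa_at c j = Idl\<^bsub>coord_ring (length us) (length vs)\<^esub> (kappa_generators c j)"

definition I_kappa :: "(nat \<Rightarrow> nat) \<Rightarrow> cpoly set" where
  "I_kappa c = Idl\<^bsub>coord_ring (length us) (length vs)\<^esub> (\<Union>j<length us. I_kappa_at c j)"

end

end

theory Submission
  imports Defs "HOL-Library.Sublist"
begin

text \<open>
  At a tensor \<open>x = \<Sum>\<^sub>i u\<^sub>i \<otimes> v\<^sub>i \<otimes> v\<^sub>i\<close> with \<open>r\<close> summands, \<open>\<psi>\<^sub>j\<^sub>,\<^sub>x\<close> is the sum of the maps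
  \<open>v \<otimes> \<omega> \<mapsto> v\<^sub>i(v) v\<^sub>i \<otimes> (u\<^sub>i \<and> \<omega>)\<close>. Multiplication by \<open>u \<noteq> 0\<close> on the \<open>j\<close>-th exterior power factors
  through that of \<open>U\<^sup>* / \<langle>u\<rangle>\<close>, of dimension \<open>m - 1\<close> choose \<open>j\<close>, so \<open>\<psi>\<^sub>j\<^sub>,\<^sub>x\<close> has rank at most
  \<open>c\<^sub>j\<close> and its minors of size \<open>c\<^sub>j + 1\<close> vanish. A skew-symmetric matrix with a nonzero kernel vector has
  zero Pfaffian, so in the skew-symmetric case the Pfaffians of size \<open>c\<^sub>j + 2\<close> vanish too. The generators
  are homogeneous, so they lie in the ideal of the Zariski closure of the set of all \<open>[x]\<close>.
\<close>

section \<open>Exterior products of forms\<close>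

lemma wedge_Nil [simp]: "wedge u \<omega> [] = 0"
  by (simp add: wedge_def)

text \<open>Contraction with the first argument is an antiderivation; the minus sign comes from
  shifting the positions in \<open>l\<close> by one. This recursion replaces the defining sum in the
  inductions over argument lists.\<close>

lemma wedge_Cons:
  "wedge u \<omega> (a # l) = u a * \<omega> l - wedge u (\<lambda>l'. \<omega> (a # l')) l"
proof -
  have "{j. Suc j \<in> - {0}} = UNIV" "\<And>i. {j. Suc j \<in> - {Suc i}} = - {i}"
    by auto
  then show ?thesis
    by (simp add: wedge_def sum.lessThan_Suc_shift nths_Cons nths_all sum_negf Compl_eq mult.assoc
        del: sum.lessThan_Suc)
qed

lemma wedge_scale: "wedge u (\<lambda>l. c * \<omega> l) l = c * wedge u \<omega> l"
  unfolding wedge_def sum_distrib_left by (intro sum.cong refl) (simp only: ac_simps)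

lemma wedge_add: "wedge u (\<lambda>l. \<omega> l + \<eta> l) l = wedge u \<omega> l + wedge u \<eta> l"
  unfolding wedge_def by (simp add: algebra_simps sum.distrib)

lemma wedge_diff: "wedge u (\<lambda>l. \<omega> l - \<eta> l) l = wedge u \<omega> l - wedge u \<eta> l"
  unfolding wedge_def by (simp add: algebra_simps sum_subtractf)

lemma wedge_sum:
  "finite I \<Longrightarrow> wedge u (\<lambda>l. \<Sum>i\<in>I. \<omega> i l) l = (\<Sum>i\<in>I. wedge u (\<omega> i) l)"
  by (induction I rule: finite_induct) (simp_all add: wedge_add, simp add: wedge_def)

lemma eq_uminus_self_iff: "x = - x \<longleftrightarrow> x = 0" for x :: complex
  unfolding eq_neg_iff_add_eq_0 by simp

text \<open>Two expansions at \<open>a # l\<close> give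
  \<open>u a * wedge w \<omega> l - w a * wedge u \<omega> l\<close> plus the same iterated product
  for the contraction of \<open>\<omega>\<close> with \<open>a\<close>. The first two terms are
  antisymmetric in \<open>u\<close> and \<open>w\<close>, the last one by induction.\<close>

lemma wedge_anticommute: "wedge u (wedge w \<omega>) l = - wedge w (wedge u \<omega>) l"
proof (induction l arbitrary: \<omega>)
  case (Cons a l)
  then show ?case
    by (simp add: wedge_Cons wedge_diff wedge_scale)
qed simp

lemma wedge_wedge: "wedge u (wedge u \<omega>) l = 0"
  by (rule iffD1[OF eq_uminus_self_iff wedge_anticommute])

lemma subseq_nths: "subseq (nths l A) l"
  unfolding in_set_subseqs[symmetric]
  by (induction l arbitrary: A) (auto simp: nths_Cons Let_def)

text \<open>Serves to compare forms that agree only on lists of basis vectors: deleting arguments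
  from such a list keeps it of that kind.\<close>

lemma wedge_cong:
  assumes "\<And>l'. subseq l' l \<Longrightarrow> \<omega> l' = \<eta> l'"
  shows "wedge u \<omega> l = wedge u \<eta> l"
  unfolding wedge_def by (intro sum.cong refl) (simp add: assms subseq_nths)

text \<open>Stated for adjacent transpositions, which generate all permutations and suit induction
  on the prefix \<open>xs\<close>.\<close>

definition alternating :: "('u list \<Rightarrow> complex) \<Rightarrow> bool" where
  "alternating \<omega> \<longleftrightarrow> (\<forall>xs a b ys. \<omega> (xs @ a # b # ys) = - \<omega> (xs @ b # a # ys))"

lemma alternating_swap:
  "alternating \<omega> \<Longrightarrow> \<omega> (xs @ a # b # ys) = - \<omega> (xs @ b # a # ys)"
  unfolding alternating_def by (elim allE)

lemma alternating_Cons: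
  assumes "alternating \<omega>"
  shows "alternating (\<lambda>l. \<omega> (a # l))"
proof -
  have "\<omega> (a # xs @ b # c # ys) = - \<omega> (a # xs @ c # b # ys)" for xs b c ys
    by (rule alternating_swap[OF assms, of "a # xs" b c ys, unfolded append_Cons])
  then show ?thesis
    unfolding alternating_def by (intro allI)
qed

text \<open>Induction on the arguments before the swapped pair. A pair at the front is settled by
  expanding twice; otherwise contraction with the first argument is again alternating.\<close>

lemma alternating_wedge:
  assumes "alternating \<omega>"
  shows "alternating (wedge u \<omega>)"
proof -
  have "wedge u \<omega> (xs @ a # b # ys) = - wedge u \<omega> (xs @ b # a # ys)" for xs a b ys
    using assms
  proof (induction xs arbitrary: \<omega>)
    case Nil
    have "wedge u (\<lambda>l. \<omega> (a # b # l)) ys = wedge u (\<lambda>l. (-1) * \<omega> (b # a # l)) ys"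
      using alternating_swap[OF Nil, of "[]" a b] by simp
    then show ?case
      unfolding wedge_scale by (simp add: wedge_Cons)
  next
    case (Cons x xs)
    have "u x * \<omega> (xs @ a # b # ys) - wedge u (\<lambda>l. \<omega> (x # l)) (xs @ a # b # ys) =
        u x * - \<omega> (xs @ b # a # ys) - - wedge u (\<lambda>l. \<omega> (x # l)) (xs @ b # a # ys)"
      by (intro arg_cong2[of _ _ _ _ "(-)"] arg_cong[of _ _ "(*) (u x)"]
          alternating_swap[OF Cons.prems] Cons.IH alternating_Cons Cons.prems)
    then show ?case
      unfolding append_Cons wedge_Cons by (simp only: mult_minus_right minus_diff_eq diff_minus_eq_add uminus_add_conv_diff)
  qed
  then show ?thesis
    unfolding alternating_def by (intro allI)
qed

text \<open>Adjacent swaps move the front \<open>a\<close> up to its second occurrence, where one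
  more swap equates the value with its own negative.\<close>

lemma alternating_repeated:
  assumes "alternating \<omega>" and "a \<in> set l"
  shows "\<omega> (a # l) = 0"
proof -
  have *: "\<omega> (ws @ a # xs @ a # ys) = 0" for ws xs ys
  proof (induction xs arbitrary: ws)
    case Nil
    then show ?case
      using iffD1[OF eq_uminus_self_iff alternating_swap[OF assms(1), of ws a a ys]] by simp
  next
    case (Cons x xs)
    have "\<omega> (ws @ x # a # xs @ a # ys) = 0"
      using Cons.IH[of "ws @ [x]"] by simp
    then show ?case
      unfolding append_Cons alternating_swap[OF assms(1), of ws a x] by simp
  qed
  obtain xs ys where l: "l = xs @ a # ys"
    using split_list[OF assms(2)] by (elim exE)
  show ?thesis
    using *[of "[]" xs ys] by (simp only: l append_Nil)
qed

section \<open>Determinants and Pfaffians of matrices of low rank\<close>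

text \<open>The matrix factors through \<open>card I\<close> indices. Padding both factors with
  zeros to size \<open>k\<close> makes it a product of square matrices, the second of which has a
  zero row.\<close>

lemma det_factor_eq_0:
  fixes A :: "nat \<Rightarrow> 'i \<Rightarrow> 'a :: idom"
  assumes "finite I" and "card I < k"
  shows "det (mat k k (\<lambda>(p, q). \<Sum>t\<in>I. A p t * B t q)) = 0"
proof -
  obtain g where g: "bij_betw g {..<card I} I"
    using ex_bij_betw_nat_finite[OF assms(1)] by (auto simp: lessThan_atLeast0)
  define A' where "A' = mat k k (\<lambda>(p, t). if t < card I then A p (g t) else 0)"
  define B' where "B' = mat k k (\<lambda>(t, q). if t < card I then B (g t) q else 0)"
  have carr: "A' \<in> carrier_mat k k" "B' \<in> carrier_mat k k"
    by (simp_all add: A'_def B'_def)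
  have "(\<Sum>t\<in>I. A p t * B t q) =
      (\<Sum>t<k. (if t < card I then A p (g t) else 0) * (if t < card I then B (g t) q else 0))" for p q
  proof -
    have "(\<Sum>t\<in>I. A p t * B t q) = (\<Sum>t<card I. A p (g t) * B (g t) q)"
      by (rule sum.reindex_bij_betw[OF g, symmetric])
    also have "\<dots> = (\<Sum>t<k. (if t < card I then A p (g t) else 0) * (if t < card I then B (g t) q else 0))"
      using assms(2) by (intro sum.mono_neutral_cong_left) auto
    finally show ?thesis .
  qed
  then have "mat k k (\<lambda>(p, q). \<Sum>t\<in>I. A p t * B t q) = A' * B'"
    by (intro eq_matI) (auto simp: A'_def B'_def scalar_prod_def lessThan_atLeast0)
  moreover have "det B' = 0"
  proof -
    \<comment> \<open>\<open>card I\<close> is the index of the first padding row, which exists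
      because \<open>card I < k\<close>.\<close>
    have "row B' (card I) = 0\<^sub>v k"
      using assms(2) by (intro eq_vecI) (auto simp: B'_def)
    then have "mat\<^sub>r k k (\<lambda>i. if i = card I then 0\<^sub>v k else row B' i) = B'"
      using carr by (intro eq_matI) (auto simp: B'_def)
    moreover have "(\<lambda>i. row B' i) \<in> {0..<k} \<rightarrow> carrier_vec k"
      using carr by auto
    ultimately show ?thesis
      using det_row_0[OF assms(2), of "row B'"] by simp
  qed
  ultimately show ?thesis
    by (simp add: det_mult[OF carr])
qed

lemma prod_even_odd:
  fixes k :: nat
  shows   "(\<Prod>i<k. h (2 * i) * h (2 * i + 1)) = (\<Prod>l<2 * k. h l :: 'a :: comm_monoid_mult)"
  by (induction k) (simp_all add: mult.assoc)

text \<open>The sum in \<open>pfaffian\<close>, over the complex numbers and without the nonzero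
  constant in front: what remains after evaluating the entries at a point.\<close>

definition pf_sum :: "nat \<Rightarrow> (nat \<Rightarrow> nat \<Rightarrow> complex) \<Rightarrow> complex" where
  "pf_sum k K = (\<Sum>\<sigma> | \<sigma> permutes {..<2 * k}.
    of_int (sign \<sigma>) * (\<Prod>i<k. K (\<sigma> (2 * i)) (\<sigma> (2 * i + 1))))"

text \<open>Expanding the product over \<open>i\<close> by choices \<open>g\<close> of an index pair
  for each \<open>i\<close> and exchanging sums leaves, for every \<open>g\<close>, the determinant
  of \<open>2 * k\<close> columns of \<open>C\<close>. Fewer than \<open>2 * k\<close> columns are
  available, so one is repeated.\<close>

lemma pf_sum_factor_eq_0:
  assumes K: "\<And>p q. p < 2 * k \<Longrightarrow> q < 2 * k \<Longrightarrow>
      K p q = (\<Sum>s\<in>I. \<Sum>t\<in>I. C p s * D s t * C q t)"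
    and I: "finite I" "card I < 2 * k"
  shows "pf_sum k K = 0"
proof -
  let ?G = "PiE {..<k} (\<lambda>_. I \<times> I)"
  \<comment> \<open>\<open>f g\<close> lists the chosen indices as first, second, first, second and
    so on, to match the arguments \<open>\<sigma> (2 * i)\<close> and
    \<open>\<sigma> (2 * i + 1)\<close>.\<close>
  define f where "f g l = (if even l then fst else snd) (g (l div 2))" for g :: "nat \<Rightarrow> 'a \<times> 'a" and l
  have perm: "of_int (sign \<sigma>) * (\<Prod>i<k. K (\<sigma> (2 * i)) (\<sigma> (2 * i + 1))) =
      (\<Sum>g\<in>?G. (\<Prod>i<k. D (fst (g i)) (snd (g i))) *
        (of_int (sign \<sigma>) * (\<Prod>l<2 * k. C (\<sigma> l) (f g l))))"
    if \<sigma>: "\<sigma> permutes {..<2 * k}" for \<sigma>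
  proof -
    have "(\<Prod>i<k. K (\<sigma> (2 * i)) (\<sigma> (2 * i + 1))) =
        (\<Prod>i<k. \<Sum>z\<in>I \<times> I. C (\<sigma> (2 * i)) (fst z) * D (fst z) (snd z) * C (\<sigma> (2 * i + 1)) (snd z))"
    proof (rule prod.cong[OF refl])
      fix i assume "i \<in> {..<k}"
      then have "\<sigma> (2 * i) < 2 * k" "\<sigma> (2 * i + 1) < 2 * k"
        using permutes_in_image[OF \<sigma>, of "2 * i"] permutes_in_image[OF \<sigma>, of "2 * i + 1"] by auto
      then show "K (\<sigma> (2 * i)) (\<sigma> (2 * i + 1)) =
          (\<Sum>z\<in>I \<times> I. C (\<sigma> (2 * i)) (fst z) * D (fst z) (snd z) * C (\<sigma> (2 * i + 1)) (snd z))"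
        by (simp add: K sum.cartesian_product case_prod_unfold)
    qed
    also have "\<dots> = (\<Sum>g\<in>?G. \<Prod>i<k. C (\<sigma> (2 * i)) (fst (g i)) * D (fst (g i)) (snd (g i)) *
        C (\<sigma> (2 * i + 1)) (snd (g i)))"
      using I by (intro prod_sum_PiE) auto
    also have "\<dots> = (\<Sum>g\<in>?G. (\<Prod>i<k. D (fst (g i)) (snd (g i))) * (\<Prod>l<2 * k. C (\<sigma> l) (f g l)))"
    proof (rule sum.cong[OF refl])
      fix g
      have "(\<Prod>l<2 * k. C (\<sigma> l) (f g l)) =
          (\<Prod>i<k. C (\<sigma> (2 * i)) (fst (g i)) * C (\<sigma> (2 * i + 1)) (snd (g i)))"
        unfolding prod_even_odd[symmetric] by (simp add: f_def)
      then show "(\<Prod>i<k. C (\<sigma> (2 * i)) (fst (g i)) * D (fst (g i)) (snd (g i)) *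
          C (\<sigma> (2 * i + 1)) (snd (g i))) =
          (\<Prod>i<k. D (fst (g i)) (snd (g i))) * (\<Prod>l<2 * k. C (\<sigma> l) (f g l))"
        by (simp add: prod.distrib[symmetric] ac_simps)
    qed
    finally show ?thesis
      by (simp add: sum_distrib_left mult.left_commute)
  qed
  have inner: "(\<Sum>\<sigma> | \<sigma> permutes {..<2 * k}. of_int (sign \<sigma>) * (\<Prod>l<2 * k. C (\<sigma> l) (f g l))) = 0"
    if g: "g \<in> ?G" for g
  proof -
    have sub: "f g ` {..<2 * k} \<subseteq> I"
    proof
      fix y assume "y \<in> f g ` {..<2 * k}"
      then obtain l where l: "l < 2 * k" "y = f g l" by auto
      then have "g (l div 2) \<in> I \<times> I" using PiE_mem[OF g, of "l div 2"] by auto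
      then show "y \<in> I" using l by (auto simp: f_def)
    qed
    \<comment> \<open>Pigeonhole principle; the repeated index yields two equal rows of
      \<open>?A\<close>.\<close>
    have "\<not> inj_on (f g) {..<2 * k}"
      using card_inj_on_le[OF _ sub I(1)] I(2) by auto
    then obtain a b where ab: "a < 2 * k" "b < 2 * k" "a \<noteq> b" "f g a = f g b"
      by (auto simp: inj_on_def)
    let ?A = "mat (2 * k) (2 * k) (\<lambda>(l, p). C p (f g l))"
    have "det ?A = 0"
      using ab by (intro det_identical_rows[of _ "2 * k" a b]) (auto simp: row_def)
    moreover have "det ?A = (\<Sum>\<sigma> | \<sigma> permutes {..<2 * k}. of_int (sign \<sigma>) * (\<Prod>l<2 * k. C (\<sigma> l) (f g l)))"
      unfolding det_def lessThan_atLeast0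
      by (auto intro!: sum.cong prod.cong simp: permutes_in_image)
    ultimately show ?thesis by simp
  qed
  show ?thesis
    unfolding pf_sum_def
    by (subst sum.cong[OF refl perm], simp, subst sum.swap)
       (simp add: sum_distrib_left[symmetric] inner)
qed

text \<open>
  A kernel vector with nonzero \<open>q\<close>-th entry expresses the \<open>q\<close>-th column of \<open>K\<close> by the others, and by
  skew-symmetry also the \<open>q\<close>-th row; hence \<open>K = C K C\<^sup>T\<close> where the \<open>q\<close>-th column of \<open>C\<close> is zero.
\<close>

lemma pf_sum_skew_eq_0:
  assumes skew: "\<And>p q. p < 2 * k \<Longrightarrow> q < 2 * k \<Longrightarrow> K q p = - K p q"
    and det: "det (mat (2 * k) (2 * k) (\<lambda>(p, q). K p q)) = 0"
  shows "pf_sum k K = 0"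
proof -
  let ?n = "2 * k"
  let ?M = "mat ?n ?n (\<lambda>(p, q). K p q)"
  obtain v where v: "v \<in> carrier_vec ?n" "v \<noteq> 0\<^sub>v ?n" "?M *\<^sub>v v = 0\<^sub>v ?n"
    using det det_0_iff_vec_prod_zero_field[of ?M ?n] by auto
  then obtain q where q: "q < ?n" "v $ q \<noteq> 0"
    by (metis carrier_vecD eq_vecI index_zero_vec)
  have ker: "(\<Sum>s<?n. K p s * v $ s) = 0" if "p < ?n" for p
    using arg_cong[OF v(3), of "\<lambda>w. w $ p"] that v(1) by (simp add: scalar_prod_def lessThan_atLeast0)
  define I where "I = {..<?n} - {q}"
  \<comment> \<open>Row \<open>q\<close> holds the coefficients of the kernel relation solved for
    column \<open>q\<close> of \<open>K\<close>; the other rows are unit vectors.\<close>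
  define C where "C p s = (if p = q then - v $ s / v $ q else if p = s then 1 else 0)" for p s
  have I: "finite I" "card I < ?n"
    using q by (auto simp: I_def)
  have row: "K p s = (\<Sum>t\<in>I. K p t * C s t)" if p: "p < ?n" and s: "s < ?n" for p s
  proof (cases "s = q")
    case True
    have "K p q * v $ q + (\<Sum>t\<in>I. K p t * v $ t) = 0"
      unfolding I_def using ker[OF p] sum.remove[of "{..<?n}" q "\<lambda>s. K p s * v $ s"] q by simp
    then have "K p q = - (\<Sum>t\<in>I. K p t * v $ t) / v $ q"
      using q by (simp add: field_simps eq_neg_iff_add_eq_0)
    then show ?thesis
      by (simp add: True C_def sum_divide_distrib sum_negf)
  next
    case False
    then have "(\<Sum>t\<in>I. K p t * C s t) = (\<Sum>t\<in>I. if s = t then K p t else 0)"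
      by (intro sum.cong) (auto simp: C_def)
    also have "\<dots> = K p s"
      using False s I(1) by (simp add: sum.delta' I_def)
    finally show ?thesis ..
  qed
  have col: "K p s = (\<Sum>t\<in>I. C p t * K t s)" if p: "p < ?n" and s: "s < ?n" for p s
  proof -
    have "K p s = - K s p" by (rule skew[OF s p])
    also have "\<dots> = (\<Sum>t\<in>I. - K s t * C p t)"
      by (simp add: row[OF s p] sum_negf)
    also have "\<dots> = (\<Sum>t\<in>I. C p t * K t s)"
    proof (rule sum.cong[OF refl])
      fix t assume "t \<in> I"
      then have "K t s = - K s t" by (intro skew[OF s]) (simp add: I_def)
      then show "- K s t * C p t = C p t * K t s" by simp
    qed
    finally show ?thesis .
  qed
  show ?thesis
  proof (rule pf_sum_factor_eq_0[OF _ I])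
    fix p s assume ps: "p < ?n" "s < ?n"
    \<comment> \<open>Inserting the row expansion into the column expansion leaves both sums over
      \<open>I\<close>, which has one index fewer than the matrix.\<close>
    have "(\<Sum>t\<in>I. C p t * K t s) = (\<Sum>t\<in>I. C p t * (\<Sum>u\<in>I. K t u * C s u))"
      using ps by (intro sum.cong refl arg_cong2[of _ _ _ _ "(*)"] row) (auto simp: I_def)
    then show "K p s = (\<Sum>t\<in>I. \<Sum>u\<in>I. C p t * K t u * C s u)"
      using col[OF ps] by (simp add: sum_distrib_left mult.assoc)
  qed
qed


section \<open>Evaluation and degree of polynomials\<close>

definition mono_eval :: "(var \<Rightarrow> complex) \<Rightarrow> (var \<Rightarrow>\<^sub>0 nat) \<Rightarrow> complex" where
  "mono_eval x t = (\<Prod>v\<in>Poly_Mapping.keys t. x v ^ Poly_Mapping.lookup t v)"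

lemma mono_eval_superset:
  assumes "finite A" and "Poly_Mapping.keys t \<subseteq> A"
  shows "mono_eval x t = (\<Prod>v\<in>A. x v ^ Poly_Mapping.lookup t v)"
  unfolding mono_eval_def using assms
  by (intro prod.mono_neutral_left) (auto simp: in_keys_iff)

lemma mono_eval_add: "mono_eval x (s + t) = mono_eval x s * mono_eval x t"
proof -
  let ?A = "Poly_Mapping.keys s \<union> Poly_Mapping.keys t"
  have "mono_eval x (s + t) = (\<Prod>v\<in>?A. x v ^ Poly_Mapping.lookup (s + t) v)"
    using Poly_Mapping.keys_add[of s t] by (intro mono_eval_superset) auto
  then show ?thesis
    by (simp add: mono_eval_superset[of ?A] lookup_add power_add prod.distrib)
qed

text \<open>Keys can cancel in a sum of polynomials, so evaluations are compared over a common
  finite superset of the keys.\<close>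

lemma poly_eval_superset:
  assumes "finite A" and "Poly_Mapping.keys p \<subseteq> A"
  shows "poly_eval p x = (\<Sum>t\<in>A. Poly_Mapping.lookup p t * mono_eval x t)"
  unfolding poly_eval_def mono_eval_def[symmetric] using assms
  by (intro sum.mono_neutral_left) (auto simp: in_keys_iff)

lemma poly_eval_add: "poly_eval (p + q) x = poly_eval p x + poly_eval q x"
proof -
  let ?A = "Poly_Mapping.keys p \<union> Poly_Mapping.keys q"
  have "poly_eval (p + q) x = (\<Sum>t\<in>?A. Poly_Mapping.lookup (p + q) t * mono_eval x t)"
    using Poly_Mapping.keys_add[of p q] by (intro poly_eval_superset) auto
  then show ?thesis
    by (simp add: poly_eval_superset[of ?A] lookup_add distrib_right sum.distrib)
qed

lemma poly_eval_0 [simp]: "poly_eval 0 x = 0"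
  by (simp add: poly_eval_def)

lemma poly_eval_sum: "poly_eval (\<Sum>i\<in>I. p i) x = (\<Sum>i\<in>I. poly_eval (p i) x)"
  by (induction I rule: infinite_finite_induct) (simp_all add: poly_eval_add)

lemma poly_eval_single: "poly_eval (Poly_Mapping.single t c) x = c * mono_eval x t"
  by (subst poly_eval_superset[of "{t}"]) auto

lemma sum_monomials:
  "p = (\<Sum>t\<in>Poly_Mapping.keys p. Poly_Mapping.single t (Poly_Mapping.lookup p t))" for p :: cpoly
proof (rule poly_mapping_eqI)
  fix s
  have "(\<Sum>t\<in>Poly_Mapping.keys p. Poly_Mapping.lookup p t when t = s) =
      (\<Sum>t\<in>Poly_Mapping.keys p. if s = t then Poly_Mapping.lookup p t else 0)"
    by (intro sum.cong) (auto simp: when_def)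
  then show "Poly_Mapping.lookup p s = Poly_Mapping.lookup
      (\<Sum>t\<in>Poly_Mapping.keys p. Poly_Mapping.single t (Poly_Mapping.lookup p t)) s"
    by (simp add: lookup_sum lookup_single in_keys_iff)
qed

lemma poly_eval_mult: "poly_eval (p * q) x = poly_eval p x * poly_eval q x"
proof -
  let ?m = "\<lambda>p t. Poly_Mapping.single t (Poly_Mapping.lookup p t) :: cpoly"
  have "p * q = (\<Sum>s\<in>Poly_Mapping.keys p. ?m p s) * (\<Sum>t\<in>Poly_Mapping.keys q. ?m q t)"
    using sum_monomials[of p] sum_monomials[of q] by simp
  then have "poly_eval (p * q) x = (\<Sum>s\<in>Poly_Mapping.keys p. \<Sum>t\<in>Poly_Mapping.keys q.
      Poly_Mapping.lookup p s * Poly_Mapping.lookup q t * (mono_eval x s * mono_eval x t))"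
    by (simp only: sum_product mult_single poly_eval_sum poly_eval_single mono_eval_add)
  also have "\<dots> = poly_eval p x * poly_eval q x"
    unfolding poly_eval_superset[OF finite_keys subset_refl] sum_product
    by (intro sum.cong refl) (simp only: ac_simps)
  finally show ?thesis .
qed

text \<open>Makes evaluation commute with determinants and with the products and signs in
  Pfaffians.\<close>

lemma comm_ring_hom_poly_eval: "comm_ring_hom (\<lambda>p. poly_eval p x)"
proof
  show "poly_eval 1 x = 1"
    using poly_eval_single[of 0 1 x] by (simp add: mono_eval_def)
qed (simp_all add: poly_eval_add poly_eval_mult)

section \<open>Homogeneous forms and their degrees\<close>

lemma mono_degree_superset:
  assumes "finite A" and "Poly_Mapping.keys t \<subseteq> A"
  shows "mono_degree t = (\<Sum>v\<in>A. Poly_Mapping.lookup t v)"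
  unfolding mono_degree_def using assms
  by (intro sum.mono_neutral_left) (auto simp: in_keys_iff)

lemma mono_degree_add: "mono_degree (s + t) = mono_degree s + mono_degree t"
proof -
  let ?A = "Poly_Mapping.keys s \<union> Poly_Mapping.keys t"
  have "mono_degree (s + t) = (\<Sum>v\<in>?A. Poly_Mapping.lookup (s + t) v)"
    using Poly_Mapping.keys_add[of s t] by (intro mono_degree_superset) auto
  then show ?thesis
    by (simp add: mono_degree_superset[of ?A] lookup_add sum.distrib)
qed

text \<open>The degree is a parameter because a sum of homogeneous polynomials need not be
  homogeneous unless the degrees agree; zero has every degree.\<close>

definition form_of_degree :: "nat \<Rightarrow> nat \<Rightarrow> nat \<Rightarrow> cpoly \<Rightarrow> bool" where
  "form_of_degree m n d p \<longleftrightarrow>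
    (\<forall>t\<in>Poly_Mapping.keys p. Poly_Mapping.keys t \<subseteq> coord_vars m n \<and> mono_degree t = d)"

lemma form_of_degreeD:
  assumes "form_of_degree m n d p"
  shows "p \<in> carrier (coord_ring m n)" and "homogeneous p"
  using assms by (auto simp: form_of_degree_def coord_ring_def homogeneous_def)

lemma form_of_degree_sum:
  assumes "\<And>i. i \<in> I \<Longrightarrow> form_of_degree m n d (p i)"
  shows "form_of_degree m n d (\<Sum>i\<in>I. p i)"
proof -
  have "Poly_Mapping.keys (\<Sum>i\<in>I. p i) \<subseteq> (\<Union>i\<in>I. Poly_Mapping.keys (p i))"
  proof (induction I rule: infinite_finite_induct)
    case (insert i I)
    then show ?case
      using Poly_Mapping.keys_add[of "p i" "\<Sum>i\<in>I. p i"] by auto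
  qed simp_all
  then show ?thesis
    using assms unfolding form_of_degree_def by blast
qed

lemma form_of_degree_mult:
  assumes "form_of_degree m n d p" and "form_of_degree m n e q"
  shows "form_of_degree m n (d + e) (p * q)"
  unfolding form_of_degree_def
proof
  fix t assume "t \<in> Poly_Mapping.keys (p * q)"
  then obtain a b where t: "t = a + b" "a \<in> Poly_Mapping.keys p" "b \<in> Poly_Mapping.keys q"
    using keys_mult[of p q] by blast
  with assms have "Poly_Mapping.keys a \<subseteq> coord_vars m n" "mono_degree a = d"
    "Poly_Mapping.keys b \<subseteq> coord_vars m n" "mono_degree b = e"
    by (auto simp: form_of_degree_def)
  then show "Poly_Mapping.keys t \<subseteq> coord_vars m n \<and> mono_degree t = d + e"
    using Poly_Mapping.keys_add[of a b] by (auto simp: t(1) mono_degree_add)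
qed

lemma form_of_degree_const: "form_of_degree m n 0 (Poly_Mapping.single 0 c)"
  by (simp add: form_of_degree_def mono_degree_def)

lemma form_of_degree_of_int: "form_of_degree m n 0 (of_int z)"
  using form_of_degree_const[of m n "of_int z"] by simp

lemma form_of_degree_prod:
  assumes "finite I" and "\<And>i. i \<in> I \<Longrightarrow> form_of_degree m n 1 (p i)"
  shows "form_of_degree m n (card I) (\<Prod>i\<in>I. p i)"
  using assms
proof (induction I rule: finite_induct)
  case empty
  then show ?case
    using form_of_degree_of_int[of m n 1] by simp
next
  case (insert i I)
  then show ?case
    using form_of_degree_mult[of m n 1 "p i" "card I" "\<Prod>i\<in>I. p i"] by simp
qed

lemma form_of_degree_det:
  assumes "\<And>p q. p < k \<Longrightarrow> q < k \<Longrightarrow> form_of_degree m n 1 (M p q)"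
  shows "form_of_degree m n k (det (mat k k (\<lambda>(p, q). M p q)))"
  unfolding det_def'[OF mat_carrier]
proof (rule form_of_degree_sum)
  fix \<pi> assume "\<pi> \<in> {\<pi>. \<pi> permutes {0..<k}}"
  then have \<pi>: "\<pi> i < k" if "i < k" for i
    using permutes_in_image[of \<pi> "{0..<k}" i] that by simp
  have "form_of_degree m n (card {0..<k}) (\<Prod>i = 0..<k. mat k k (\<lambda>(p, q). M p q) $$ (i, \<pi> i))"
    using \<pi> assms by (intro form_of_degree_prod) auto
  from form_of_degree_mult[OF form_of_degree_of_int this]
  show "form_of_degree m n k (of_int (sign \<pi>) * (\<Prod>i = 0..<k. mat k k (\<lambda>(p, q). M p q) $$ (i, \<pi> i)))"
    by simp
qed

lemma form_of_degree_pfaffian: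
  assumes "\<And>p q. p < 2 * k \<Longrightarrow> q < 2 * k \<Longrightarrow> form_of_degree m n 1 (M p q)"
  shows "form_of_degree m n k (pfaffian k M)"
proof -
  have "form_of_degree m n k (\<Sum>\<sigma> | \<sigma> permutes {..<2 * k}.
      of_int (sign \<sigma>) * (\<Prod>i<k. M (\<sigma> (2 * i)) (\<sigma> (2 * i + 1))))"
  proof (rule form_of_degree_sum)
    fix \<sigma> assume "\<sigma> \<in> {\<sigma>. \<sigma> permutes {..<2 * k}}"
    then have \<sigma>: "\<sigma> i < 2 * k" if "i < 2 * k" for i
      using permutes_in_image[of \<sigma> "{..<2 * k}" i] that by simp
    have "form_of_degree m n (card {..<k}) (\<Prod>i<k. M (\<sigma> (2 * i)) (\<sigma> (2 * i + 1)))"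
      by (intro form_of_degree_prod assms \<sigma>) auto
    from form_of_degree_mult[OF form_of_degree_of_int this]
    show "form_of_degree m n k (of_int (sign \<sigma>) * (\<Prod>i<k. M (\<sigma> (2 * i)) (\<sigma> (2 * i + 1))))"
      by simp
  qed
  from form_of_degree_mult[OF form_of_degree_const this] show ?thesis
    unfolding pfaffian_def by simp
qed


section \<open>The flattenings at a sum of rank one tensors\<close>

text \<open>A sublist of a distinct list is determined by its set of entries, here a
  \<open>j\<close>-subset of the entries other than \<open>x\<close>. This is the source of the
  binomial coefficient in the rank bound.\<close>

lemma card_subseqs_avoiding:
  assumes "distinct xs" and "x \<in> set xs"
  shows "card {t. subseq t xs \<and> length t = j \<and> x \<notin> set t} \<le> (length xs - 1) choose j"
proof -
  let ?L = "{t. subseq t xs \<and> length t = j \<and> x \<notin> set t}"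
  have inj: "inj_on set ?L"
    using distinct_set_subseqs[OF assms(1)]
    by (auto simp: distinct_map set_subseqs_eq intro: inj_on_subset)
  have "set ` ?L \<subseteq> {B. B \<subseteq> set xs - {x} \<and> card B = j}"
  proof
    fix B assume "B \<in> set ` ?L"
    then obtain t where t: "B = set t" "subseq t xs" "length t = j" "x \<notin> set t" by auto
    moreover have "distinct t"
      using subseqs_distinctD[of t xs] t(2) assms(1) by simp
    ultimately show "B \<in> {B. B \<subseteq> set xs - {x} \<and> card B = j}"
      using list_emb_set[of "(=)" t xs] by (auto simp: distinct_card)
  qed
  then have "card ?L \<le> card {B. B \<subseteq> set xs - {x} \<and> card B = j}"
    unfolding card_image[OF inj, symmetric] by (intro card_mono) auto
  also have "\<dots> = (length xs - 1) choose j"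
    using assms by (simp add: n_subsets distinct_card)
  finally show ?thesis .
qed

lemma subseq_map_obtain:
  assumes "subseq l (map f xs)"
  obtains t where "subseq t xs" and "l = map f t"
  using assms subseq_nths by (metis nths_map subseq_conv_nths)

text \<open>Pairs below the diagonal are folded onto those above it, to match the coordinates
  \<open>(i, a, b)\<close> with \<open>a \<le> b\<close>; diagonal pairs count once.\<close>

lemma sum_pairs_le:
  "(\<Sum>a<n. \<Sum>b<n. f a b) = (\<Sum>(a, b) | a \<le> b \<and> b < n. f a b + (if a = b then 0 else f b a))"
  for f :: "nat \<Rightarrow> nat \<Rightarrow> 'a :: comm_monoid_add"
proof -
  let ?P = "{(a, b). a \<le> b \<and> b < n}" and ?Q = "{(a, b). a < b \<and> b < n}"
  have fin: "finite ?P"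
    by (rule finite_subset[of _ "{..<n} \<times> {..<n}"]) auto
  have Q: "?Q \<subseteq> ?P" by auto
  have "(\<Sum>a<n. \<Sum>b<n. f a b) = (\<Sum>(a, b)\<in>{..<n} \<times> {..<n}. f a b)"
    by (rule sum.cartesian_product)
  also have "{..<n} \<times> {..<n} = ?P \<union> prod.swap ` ?Q"
    by (force simp: image_iff)
  also have "(\<Sum>(a, b)\<in>\<dots>. f a b) = (\<Sum>(a, b)\<in>?P. f a b) + (\<Sum>(a, b)\<in>prod.swap ` ?Q. f a b)"
    using fin finite_subset[OF Q fin] by (intro sum.union_disjoint) auto
  also have "(\<Sum>(a, b)\<in>prod.swap ` ?Q. f a b) = (\<Sum>(a, b)\<in>?Q. f b a)"
    by (subst sum.reindex) (auto simp: case_prod_unfold)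
  also have "\<dots> = (\<Sum>(a, b)\<in>?P. if a = b then 0 else f b a)"
    using fin by (intro sum.mono_neutral_cong_left) (auto split: if_splits)
  finally show ?thesis
    by (simp add: case_prod_unfold sum.distrib)
qed

text \<open>Subadditivity of rank: factorisations of the summands are joined over the disjoint union
  of their index sets.\<close>

lemma sum_Sigma_factor:
  fixes x y :: "nat \<Rightarrow> 'a :: comm_semiring_1"
  assumes L: "\<And>i. i < r \<Longrightarrow> finite (L i)"
    and w: "\<And>i. i < r \<Longrightarrow> w i = (\<Sum>t\<in>L i. A i t * B i t)"
  shows "(\<Sum>i<r. y i * x i * w i) =
    (\<Sum>z\<in>(SIGMA i:{..<r}. L i). (x (fst z) * A (fst z) (snd z)) * (y (fst z) * B (fst z) (snd z)))"
proof -
  have "(\<Sum>i<r. y i * x i * w i) = (\<Sum>i<r. \<Sum>t\<in>L i. (x i * A i t) * (y i * B i t))"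
    by (intro sum.cong refl) (simp add: w sum_distrib_left mult_ac)
  also have "\<dots> = (\<Sum>(i, t)\<in>(SIGMA i:{..<r}. L i). (x i * A i t) * (y i * B i t))"
    using L by (subst sum.Sigma) auto
  finally show ?thesis
    by (simp add: case_prod_unfold)
qed

context based_spaces
begin

section \<open>Coordinates of tensors and linear forms\<close>

lemma U_dual_expand:
  assumes "u \<in> U_dual"
  shows "u p = (\<Sum>i<length us. u (us ! i) * dual_basis_U i p)"
proof -
  interpret u: Vector_Spaces.linear scaleU "(*)" u
    using assms by (simp add: U_dual_def)
  have "p = (\<Sum>b\<in>set us. scaleU (U.representation (set us) p b) b)"
    using U.sum_representation_eq[of "set us" p "set us"] U.independent_Basis U.span_Basis by simp
  then have "u p = (\<Sum>b\<in>set us. U.representation (set us) p b * u b)"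
    by (metis (mono_tags, lifting) sum.cong u.scale u.sum)
  also have "\<dots> = (\<Sum>i<length us. U.representation (set us) p (us ! i) * u (us ! i))"
    by (rule sum.reindex_bij_betw[OF bij_betw_nth[OF distinct_us refl refl], symmetric])
  finally show ?thesis
    by (simp add: dual_basis_U_def mult.commute)
qed

lemma V_dual_expand:
  assumes "v \<in> V_dual"
  shows "v q = (\<Sum>a<length vs. v (vs ! a) * dual_basis_V a q)"
proof -
  interpret v: Vector_Spaces.linear scaleV "(*)" v
    using assms by (simp add: V_dual_def)
  have "q = (\<Sum>b\<in>set vs. scaleV (V.representation (set vs) q b) b)"
    using V.sum_representation_eq[of "set vs" q "set vs"] V.independent_Basis V.span_Basis by simp
  then have "v q = (\<Sum>b\<in>set vs. V.representation (set vs) q b * v b)"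
    by (metis (mono_tags, lifting) sum.cong v.scale v.sum)
  also have "\<dots> = (\<Sum>a<length vs. V.representation (set vs) q (vs ! a) * v (vs ! a))"
    by (rule sum.reindex_bij_betw[OF bij_betw_nth[OF distinct_vs refl refl], symmetric])
  finally show ?thesis
    by (simp add: dual_basis_V_def mult.commute)
qed

text \<open>Expand \<open>u\<close> and both copies of \<open>v\<close> in the dual bases. The pairs
  \<open>(a, b)\<close> and \<open>(b, a)\<close> have equal coefficients, so their terms merge into
  one element of \<open>tensor_basis\<close>.\<close>

lemma tensor_expand:
  assumes u: "u \<in> U_dual" and v: "v \<in> V_dual"
  shows "tensor u v v p q s =
    (\<Sum>t\<in>coord_vars (length us) (length vs). coords (tensor u v v) t * tensor_basis t p q s)"
proof -
  let ?m = "length us" and ?n = "length vs"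
  let ?P = "{(a, b). a \<le> b \<and> b < ?n}"
  have "v q * v s = (\<Sum>a<?n. \<Sum>b<?n.
      v (vs ! a) * v (vs ! b) * (dual_basis_V a q * dual_basis_V b s))"
    unfolding V_dual_expand[OF v, of q] V_dual_expand[OF v, of s] sum_product
    by (intro sum.cong refl) (simp only: ac_simps)
  also have "\<dots> = (\<Sum>(a, b)\<in>?P. v (vs ! a) * v (vs ! b) * (dual_basis_V a q * dual_basis_V b s +
      (if a = b then 0 else dual_basis_V b q * dual_basis_V a s)))"
    unfolding sum_pairs_le by (intro sum.cong) (auto simp: algebra_simps)
  finally have "tensor u v v p q s = (\<Sum>i<?m. u (us ! i) * dual_basis_U i p) *
      (\<Sum>(a, b)\<in>?P. v (vs ! a) * v (vs ! b) * (dual_basis_V a q * dual_basis_V b s +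
        (if a = b then 0 else dual_basis_V b q * dual_basis_V a s)))"
    unfolding tensor_def mult.assoc[of "u p"] U_dual_expand[OF u, of p] by simp
  also have "\<dots> = (\<Sum>t\<in>{..<?m} \<times> ?P. coords (tensor u v v) t * tensor_basis t p q s)"
    unfolding sum_product sum.cartesian_product
    by (intro sum.cong) (auto simp: coords_def tensor_basis_def tensor_def algebra_simps)
  also have "{..<?m} \<times> ?P = coord_vars ?m ?n"
    by (auto simp: coord_vars_def)
  finally show ?thesis .
qed

lemma finite_coord_vars: "finite (coord_vars m n)"
  by (rule finite_subset[of _ "{..<m} \<times> {..<n} \<times> {..<n}"]) (auto simp: coord_vars_def)

lemma form_of_degree_linear_form:
  "form_of_degree (length us) (length vs) 1 (linear_form \<phi>)"
  unfolding linear_form_def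
  by (rule form_of_degree_sum) (auto simp: form_of_degree_def mono_degree_def)

lemma poly_eval_linear_form:
  "poly_eval (linear_form \<phi>) x =
    (\<Sum>t\<in>coord_vars (length us) (length vs). x t * \<phi> (tensor_basis t))"
  by (simp add: linear_form_def poly_eval_sum poly_eval_single mono_eval_def mult.commute)

section \<open>Iterated exterior products and their signs\<close>

lemma wedge_list_Nil [simp]: "wedge_list [] \<omega> = \<omega>"
  by (simp add: wedge_list_def)

lemma wedge_list_Cons [simp]: "wedge_list (i # S) \<omega> = wedge (dual_basis_U i) (wedge_list S \<omega>)"
  by (simp add: wedge_list_def)

lemma wedge_list_scale: "wedge_list S (\<lambda>l. c * \<omega> l) = (\<lambda>l. c * wedge_list S \<omega> l)"
  by (induction S) (auto simp: wedge_scale)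

lemma wedge_list_zero: "wedge_list S (\<lambda>l. 0) = (\<lambda>l. 0)"
  using wedge_list_scale[of S 0 "\<lambda>l. 0"] by simp

lemma wedge_list_sum:
  "finite I \<Longrightarrow> wedge_list S (\<lambda>l. \<Sum>i\<in>I. \<omega> i l) = (\<lambda>l. \<Sum>i\<in>I. wedge_list S (\<omega> i) l)"
  by (induction S) (auto simp: wedge_sum)

lemma wedge_list_cong:
  assumes "\<And>l'. subseq l' l \<Longrightarrow> \<omega> l' = \<eta> l'"
  shows "wedge_list S \<omega> l = wedge_list S \<eta> l"
  using assms
proof (induction S arbitrary: l)
  case (Cons i S)
  then show ?case
    by (auto intro!: wedge_cong intro: subseq_order.trans)
qed simp

lemma alternating_wedge_list: "alternating \<omega> \<Longrightarrow> alternating (wedge_list S \<omega>)"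
  by (induction S) (simp_all add: alternating_wedge)

text \<open>The one-form \<open>u\<close> moves past \<open>length S\<close> one-forms, each
  contributing a sign.\<close>

lemma wedge_list_wedge:
  "wedge_list S (wedge u \<omega>) = (\<lambda>l. (-1) ^ length S * wedge u (wedge_list S \<omega>) l)"
proof (induction S)
  case (Cons i S)
  show ?case
    unfolding wedge_list_Cons Cons.IH
    by (simp add: wedge_scale wedge_anticommute[of "dual_basis_U i" u])
qed simp

lemma wedge_list_commute:
  "wedge_list S (wedge_list R \<omega>) =
    (\<lambda>l. (-1) ^ (length S * length R) * wedge_list R (wedge_list S \<omega>) l)"
proof (induction S)
  case (Cons i S)
  \<comment> \<open>The sign for moving \<open>dual_basis_U i\<close> across \<open>R\<close> occurs
    on the right twice, in the exponent and from \<open>wedge_list_wedge\<close>, and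
    cancels.\<close>
  have sign: "(-1) ^ length R * (-1) ^ k * (-1) ^ length R = (-1 :: complex) ^ k" for k
    by (cases "even (length R)") simp_all
  show ?case
    unfolding wedge_list_Cons Cons.IH wedge_list_wedge[of R]
    by (simp add: wedge_scale power_add mult.assoc[symmetric] sign)
qed simp

text \<open>For \<open>m = 2j + 1\<close> with \<open>j\<close> odd, this is the skew-symmetry of \<^const>\<open>psi_skew_matrix\<close>.\<close>

lemma wedge_list_swap:
  "wedge_list S (wedge u (wedge_list R \<omega>)) l =
    (-1) ^ (length S + length R + length S * length R) * wedge_list R (wedge u (wedge_list S \<omega>)) l"
proof -
  have "wedge_list S (wedge u (wedge_list R \<omega>)) l =
      (-1) ^ length S * wedge u (wedge_list S (wedge_list R \<omega>)) l"
    by (simp add: wedge_list_wedge)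
  also have "\<dots> = (-1) ^ (length S + length S * length R) * wedge u (wedge_list R (wedge_list S \<omega>)) l"
    unfolding wedge_list_commute[of S R] by (simp add: wedge_scale power_add)
  also have "wedge u (wedge_list R (wedge_list S \<omega>)) l =
      (-1) ^ length R * wedge_list R (wedge u (wedge_list S \<omega>)) l"
    by (simp add: wedge_list_wedge[of R] flip: power_add mult.assoc)
  finally show ?thesis
    by (simp add: power_add mult.left_commute)
qed

text \<open>A degree count: each factor uses up one argument, and \<open>unit_form\<close> is
  nonzero only on the empty list.\<close>

lemma wedge_list_unit_form_length:
  "length l \<noteq> length S \<Longrightarrow> wedge_list S unit_form l = 0"
proof (induction S arbitrary: l)
  case Nil
  then show ?case by (simp add: unit_form_def)
next
  case (Cons i S)
  have "length (nths l (- {k})) \<noteq> length S" if "k < length l" for k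
  proof -
    have "{i. i < length l \<and> i \<in> - {k}} = {..<length l} - {k}" by auto
    then show ?thesis
      using that Cons.prems by (simp add: length_nths)
  qed
  then show ?case
    by (simp add: wedge_def Cons.IH)
qed

lemma alternating_unit_form: "alternating unit_form"
  by (simp add: alternating_def unit_form_def)

lemma map_nth_labels_inj:
  assumes "subseq t [0..<length us]" and "subseq t' [0..<length us]"
    and "map ((!) us) t = map ((!) us) t'"
  shows "t = t'"
proof -
  have sub: "set t \<subseteq> {..<length us}" "set t' \<subseteq> {..<length us}"
    using list_emb_set[OF assms(1)] list_emb_set[OF assms(2)] by auto
  have "inj_on ((!) us) (set t \<union> set t')"
    using distinct_us sub by (intro inj_on_nth) auto
  from map_inj_on[OF assms(3) this] show ?thesis .
qed

text \<open>
  Multiplication by \<open>u\<close> factors through the exterior power of \<open>U\<^sup>* / \<langle>u\<rangle>\<close>: if \<open>u(p) \<noteq> 0\<close>, then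
  \<open>u(p) \<cdot> u \<and> \<omega> = u \<and> \<iota>\<^sub>p(u \<and> \<omega>)\<close>, and \<open>\<iota>\<^sub>p(u \<and> \<omega>)\<close> is determined by its values on basis vectors other
  than \<open>p\<close>.
\<close>

lemma wedge_factor:
  assumes u: "u \<in> U_dual"
  shows "\<exists>(L :: nat list set) A B. finite L \<and> card L \<le> (length us - 1) choose j \<and>
    (\<forall>S T R. subseq T [0..<length us] \<longrightarrow> length R = j \<longrightarrow>
      wedge_list S (wedge u (wedge_list R unit_form)) (map ((!) us) T) =
        (\<Sum>t\<in>L. A S T t * B t R))"
proof (cases "\<exists>k<length us. u (us ! k) \<noteq> 0")
  \<comment> \<open>Here \<open>u\<close> is zero, so all products vanish and the empty index set
    suffices.\<close>
  case False
  then have "u p = 0" for p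
    unfolding U_dual_expand[OF u, of p] by simp
  then have "wedge u \<omega> = (\<lambda>l. 0)" for \<omega>
    by (intro ext) (simp add: wedge_def)
  then have "wedge_list S (wedge u \<omega>) l = 0" for S \<omega> l
    by (simp only: wedge_list_zero)
  then show ?thesis
    by (intro exI[of _ "{}"]) simp
next
  case True
  then obtain k where k: "k < length us" "u (us ! k) \<noteq> 0" by blast
  define L where "L = {t. subseq t [0..<length us] \<and> length t = j \<and> k \<notin> set t}"
  have finL: "finite L"
    by (rule finite_subset[of _ "set (subseqs [0..<length us])"]) (auto simp: L_def)
  have cardL: "card L \<le> (length us - 1) choose j"
    using card_subseqs_avoiding[of "[0..<length us]" k j] k by (simp add: L_def)
  \<comment> \<open>The indicator of a single argument list, not an alternating form; this is enough
    because \<open>wedge\<close> and \<open>wedge_list\<close> are linear on arbitrary functions of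
    lists.\<close>
  define \<delta> where "\<delta> t l = (if l = map ((!) us) t then 1 else 0 :: complex)" for t l
  define A where "A S T t = wedge_list S (wedge u (\<delta> t)) (map ((!) us) T) / u (us ! k)" for S T t
  define \<theta> where "\<theta> R l = wedge u (wedge_list R unit_form) (us ! k # l)" for R l
  define B where "B t R = \<theta> R (map ((!) us) t)" for t R
  have factor: "wedge_list S (wedge u (wedge_list R unit_form)) (map ((!) us) T) = (\<Sum>t\<in>L. A S T t * B t R)"
    if T: "subseq T [0..<length us]" and R: "length R = j" for S T R
  proof -
    have "wedge u (wedge_list R unit_form) = (\<lambda>l. 1 / u (us ! k) * wedge u (\<theta> R) l)"
    proof
      fix l
      \<comment> \<open>Obtained by contracting the vanishing form
        \<open>wedge u (wedge u \<omega>)\<close> with \<open>us ! k\<close>.\<close>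
      have "u (us ! k) * wedge u (wedge_list R unit_form) l = wedge u (\<theta> R) l"
        using wedge_wedge[of u "wedge_list R unit_form" "us ! k # l"]
        by (subst (asm) wedge_Cons) (simp add: \<theta>_def[abs_def])
      then show "wedge u (wedge_list R unit_form) l = 1 / u (us ! k) * wedge u (\<theta> R) l"
        using k by (simp add: field_simps)
    qed
    then have "wedge_list S (wedge u (wedge_list R unit_form)) (map ((!) us) T) =
        1 / u (us ! k) * wedge_list S (wedge u (\<theta> R)) (map ((!) us) T)"
      by (simp only: wedge_list_scale)
    also have "wedge_list S (wedge u (\<theta> R)) (map ((!) us) T) =
        wedge_list S (wedge u (\<lambda>l. \<Sum>t\<in>L. B t R * \<delta> t l)) (map ((!) us) T)"
    \<comment> \<open>It suffices to compare on sublists of \<open>map ((!) us) T\<close>, which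
      come from increasing labels \<open>s\<close>.\<close>
    proof (intro wedge_list_cong wedge_cong)
      fix l' l assume "subseq l' (map ((!) us) T)" "subseq l l'"
      then have "subseq l (map ((!) us) T)"
        by (rule subseq_order.trans[rotated])
      then obtain s where s: "subseq s T" "l = map ((!) us) s"
        by (rule subseq_map_obtain)
      from s(1) T have sub: "subseq s [0..<length us]"
        by (rule subseq_order.trans)
      have "(\<Sum>t\<in>L. B t R * \<delta> t l) = (\<Sum>t\<in>L. if s = t then B t R else 0)"
        using map_nth_labels_inj[OF sub] by (intro sum.cong) (auto simp: \<delta>_def s(2) L_def)
      also have "\<dots> = (if s \<in> L then B s R else 0)"
        by (simp add: finL)
      also have "\<dots> = \<theta> R l"
      proof (cases "s \<in> L")
        case False
        \<comment> \<open>Outside \<open>L\<close> the value is zero: a wrong length fails the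
          degree count, and a label containing \<open>k\<close> repeats the argument
          \<open>us ! k\<close>.\<close>
        then consider "length s \<noteq> j" | "k \<in> set s"
          using sub by (auto simp: L_def)
        then have "\<theta> R l = 0"
        proof cases
          case 1
          then have "wedge_list R unit_form (nths (us ! k # l) (- {i})) = 0" if "i < Suc (length l)" for i
          proof -
            have "{i'. i' < Suc (length l) \<and> i' \<in> - {i}} = {..<Suc (length l)} - {i}" by auto
            then have "length (nths (us ! k # l) (- {i})) = length l"
              using that by (simp add: length_nths)
            then show ?thesis
              using 1 R s(2) by (intro wedge_list_unit_form_length) simp
          qed
          then show ?thesis
            by (simp add: \<theta>_def wedge_def)
        next
          case 2
          then show ?thesis
            unfolding \<theta>_def s(2)
            by (intro alternating_repeated alternating_wedge alternating_wedge_list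
                alternating_unit_form) auto
        qed
        with False show ?thesis by simp
      qed (simp add: B_def s(2))
      finally show "\<theta> R l = (\<Sum>t\<in>L. B t R * \<delta> t l)" ..
    qed
    also have "\<dots> = (\<Sum>t\<in>L. B t R * wedge_list S (wedge u (\<delta> t)) (map ((!) us) T))"
    proof -
      have "wedge u (\<lambda>l. \<Sum>t\<in>L. B t R * \<delta> t l) = (\<lambda>l. \<Sum>t\<in>L. B t R * wedge u (\<delta> t) l)"
        by (intro ext) (simp add: wedge_sum[OF finL] wedge_scale)
      then show ?thesis
        by (simp add: wedge_list_sum[OF finL] wedge_list_scale)
    qed
    finally show ?thesis
      by (simp add: A_def sum_distrib_left mult.commute)
  qed
  show ?thesis
    by (intro exI[of _ L] exI[of _ A] exI[of _ B] conjI allI impI finL cardL factor)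
qed

section \<open>Entries of the flattenings and their rank\<close>

definition tensor_sum ::
    "nat \<Rightarrow> (nat \<Rightarrow> 'u \<Rightarrow> complex) \<Rightarrow> (nat \<Rightarrow> 'v \<Rightarrow> complex) \<Rightarrow> 'u \<Rightarrow> 'v \<Rightarrow> 'v \<Rightarrow> complex" where
  "tensor_sum r u v = (\<lambda>p q s. \<Sum>i<r. tensor (u i) (v i) (v i) p q s)"

text \<open>With \<open>S\<close> empty these are the entries of \<^const>\<open>psi_matrix\<close>, and with \<open>T = [0, \<dots>, m - 1]\<close> those of
  \<^const>\<open>psi_skew_matrix\<close>.\<close>

definition psi_entry ::
    "nat list \<Rightarrow> nat list \<Rightarrow> nat \<Rightarrow> nat \<times> nat list \<Rightarrow> ('u \<Rightarrow> 'v \<Rightarrow> 'v \<Rightarrow> complex) \<Rightarrow> complex" where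
  "psi_entry S T b lab x = wedge_list S (psi x (domain_basis lab) (vs ! b)) (map ((!) us) T)"

lemma psi_matrix_eq: "psi_matrix lab lab' = linear_form (psi_entry [] (snd lab) (fst lab) lab')"
  unfolding psi_matrix_def psi_entry_def[abs_def] wedge_list_Nil case_prod_unfold ..

lemma psi_skew_matrix_eq:
  "psi_skew_matrix lab lab' = linear_form (psi_entry (snd lab) [0..<length us] (fst lab) lab')"
  unfolding psi_skew_matrix_def psi_entry_def[abs_def] map_nth case_prod_unfold ..

lemma psi_entry_sum:
  assumes "finite I"
  shows "psi_entry S T b lab (\<lambda>p q s. \<Sum>i\<in>I. c i * X i p q s) = (\<Sum>i\<in>I. c i * psi_entry S T b lab (X i))"
proof -
  have "psi (\<lambda>p q s. \<Sum>i\<in>I. c i * X i p q s) \<eta> s = (\<lambda>l. \<Sum>i\<in>I. c i * psi (X i) \<eta> s l)" for \<eta> s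
    unfolding psi_def sum_distrib_left
    by (rule ext, subst sum.swap, intro sum.cong refl) (simp only: ac_simps)
  then show ?thesis
    by (simp add: psi_entry_def wedge_list_sum[OF assms] wedge_list_scale)
qed

lemma psi_entry_tensor:
  assumes "v \<in> V_dual"
  shows "psi_entry S T b (a, R) (tensor u v v) =
    v (vs ! a) * v (vs ! b) * wedge_list S (wedge u (wedge_list R unit_form)) (map ((!) us) T)"
proof -
  have "psi (tensor u v v) (domain_basis (a, R)) =
      (\<lambda>s l. v (vs ! a) * v s * wedge u (wedge_list R unit_form) l)"
    using assms unfolding domain_basis_def prod.case
    by (intro psi_tensor) (simp add: V_dual_def)
  then show ?thesis
    by (simp add: psi_entry_def wedge_list_scale)
qed

lemma psi_entry_tensor_sum:
  assumes "\<And>i. i < r \<Longrightarrow> v i \<in> V_dual"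
  shows "psi_entry S T b (a, R) (tensor_sum r u v) =
    (\<Sum>i<r. v i (vs ! a) * v i (vs ! b) *
      wedge_list S (wedge (u i) (wedge_list R unit_form)) (map ((!) us) T))"
  using psi_entry_sum[of "{..<r}" S T b "(a, R)" "\<lambda>_. 1" "\<lambda>i. tensor (u i) (v i) (v i)"] assms
  by (simp add: tensor_sum_def psi_entry_tensor)

lemma tensor_sum_expand:
  assumes "\<And>i. i < r \<Longrightarrow> u i \<in> U_dual" and "\<And>i. i < r \<Longrightarrow> v i \<in> V_dual"
  shows "tensor_sum r u v = (\<lambda>p q s. \<Sum>t\<in>coord_vars (length us) (length vs).
    coords (tensor_sum r u v) t * tensor_basis t p q s)"
proof (intro ext)
  fix p q s
  have "tensor_sum r u v p q s = (\<Sum>i<r. \<Sum>t\<in>coord_vars (length us) (length vs).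
      coords (tensor (u i) (v i) (v i)) t * tensor_basis t p q s)"
    unfolding tensor_sum_def using assms by (intro sum.cong refl tensor_expand) auto
  also have "\<dots> = (\<Sum>t\<in>coord_vars (length us) (length vs).
      coords (tensor_sum r u v) t * tensor_basis t p q s)"
    by (subst sum.swap) (auto simp: coords_def tensor_sum_def sum_distrib_right intro!: sum.cong)
  finally show "tensor_sum r u v p q s = (\<Sum>t\<in>coord_vars (length us) (length vs).
      coords (tensor_sum r u v) t * tensor_basis t p q s)" .
qed

text \<open>Links polynomials to actual values: \<open>psi_entry\<close> is linear in the tensor,
  and the tensor expands in \<open>tensor_basis\<close> with its coordinates as
  coefficients.\<close>

lemma poly_eval_psi_entry:
  assumes "\<And>i. i < r \<Longrightarrow> u i \<in> U_dual" and "\<And>i. i < r \<Longrightarrow> v i \<in> V_dual"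
  shows "poly_eval (linear_form (psi_entry S T b lab)) (coords (tensor_sum r u v)) =
    psi_entry S T b lab (tensor_sum r u v)"
proof -
  let ?I = "coord_vars (length us) (length vs)"
  have "psi_entry S T b lab (tensor_sum r u v) =
      psi_entry S T b lab (\<lambda>p q s. \<Sum>t\<in>?I. coords (tensor_sum r u v) t * tensor_basis t p q s)"
    using assms by (intro arg_cong[of _ _ "psi_entry S T b lab"] tensor_sum_expand)
  then show ?thesis
    unfolding psi_entry_sum[OF finite_coord_vars] poly_eval_linear_form by (rule sym)
qed

text \<open>The rank bound: each of the \<open>r\<close> summands contributes at most as many
  indices as \<open>wedge_factor\<close> provides. \<open>A\<close> depends on the row data and
  \<open>B\<close> only on the column label, so the factorisation survives any selection of rows and
  columns.\<close>

lemma psi_entry_factor: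
  assumes u: "\<And>i. i < r \<Longrightarrow> u i \<in> U_dual" and v: "\<And>i. i < r \<Longrightarrow> v i \<in> V_dual"
  obtains I :: "(nat \<times> nat list) set" and A B
  where "finite I" and "card I \<le> r * ((length us - 1) choose j)"
    and "\<And>S T b a R. subseq T [0..<length us] \<Longrightarrow> length R = j \<Longrightarrow>
      psi_entry S T b (a, R) (tensor_sum r u v) = (\<Sum>t\<in>I. A S T b t * B t (a, R))"
proof -
  \<comment> \<open>Names the factorisation of the \<open>i\<close>-th summand, so that its three
    witnesses can be chosen as functions of \<open>i\<close>.\<close>
  define P where "P i L A B \<longleftrightarrow> finite L \<and> card L \<le> (length us - 1) choose j \<and>
    (\<forall>S T R. subseq T [0..<length us] \<longrightarrow> length R = j \<longrightarrow>
      wedge_list S (wedge (u i) (wedge_list R unit_form)) (map ((!) us) T) =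
        (\<Sum>t\<in>L. A S T t * B t R))"
    for i and L :: "nat list set" and A B
  have "\<exists>L A B. P i L A B" if "i < r" for i
    unfolding P_def by (rule wedge_factor[OF u[OF that]])
  then obtain L A B where P: "P i (L i) (A i) (B i)" if "i < r" for i
    by metis
  have L: "finite (L i)" "card (L i) \<le> (length us - 1) choose j" if "i < r" for i
    using P[OF that] unfolding P_def by simp_all
  have AB: "wedge_list S (wedge (u i) (wedge_list R unit_form)) (map ((!) us) T) =
      (\<Sum>t\<in>L i. A i S T t * B i t R)"
    if "i < r" "subseq T [0..<length us]" "length R = j" for i S T R
    using P[OF that(1)] that(2,3) unfolding P_def by simp
  let ?I = "SIGMA i:{..<r}. L i"
  have fin: "finite ?I"
    using L(1) by auto
  have card: "card ?I \<le> r * ((length us - 1) choose j)"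
    using sum_bounded_above[of "{..<r}" "\<lambda>i. card (L i)" "(length us - 1) choose j"] L
    by (subst card_SigmaI) auto
  define A' where "A' S T b z = v (fst z) (vs ! b) * A (fst z) S T (snd z)" for S T b z
  define B' where "B' z lab = v (fst z) (vs ! fst lab) * B (fst z) (snd z) (snd lab)"
    for z and lab :: "nat \<times> nat list"
  have eq: "psi_entry S T b (a, R) (tensor_sum r u v) = (\<Sum>z\<in>?I. A' S T b z * B' z (a, R))"
    if "subseq T [0..<length us]" "length R = j" for S T b a R
  proof -
    have 1: "psi_entry S T b (a, R) (tensor_sum r u v) = (\<Sum>i<r. v i (vs ! a) * v i (vs ! b) *
        wedge_list S (wedge (u i) (wedge_list R unit_form)) (map ((!) us) T))"
      by (rule psi_entry_tensor_sum) (rule v)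
    have 2: "(\<Sum>i<r. v i (vs ! a) * v i (vs ! b) *
        wedge_list S (wedge (u i) (wedge_list R unit_form)) (map ((!) us) T)) =
        (\<Sum>z\<in>?I. A' S T b z * B' z (a, R))"
      unfolding A'_def B'_def fst_conv snd_conv
    proof (rule sum_Sigma_factor[of r L "\<lambda>i. wedge_list S (wedge (u i) (wedge_list R unit_form)) (map ((!) us) T)"
          "\<lambda>i. A i S T" "\<lambda>i t. B i t R" "\<lambda>i. v i (vs ! a)" "\<lambda>i. v i (vs ! b)"])
      fix i assume i: "i < r"
      show "finite (L i)"
        by (rule L(1)[OF i])
      show "wedge_list S (wedge (u i) (wedge_list R unit_form)) (map ((!) us) T) =
          (\<Sum>t\<in>L i. A i S T t * B i t R)"
        by (rule AB[OF i that])
    qed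
    show ?thesis
      by (rule trans[OF 1 2])
  qed
  show thesis
    by (rule that[of ?I A' B', OF fin card eq])
qed


subsection \<open>Minors and Pfaffians vanish on the secant variety\<close>

lemma psi_labelsD:
  assumes "lab \<in> set (psi_labels m n j)"
  shows "subseq (snd lab) [0..<m]" and "length (snd lab) = j"
  using assms by (auto simp: psi_labels_def ext_labels_def)

lemma subseqs_nth:
  assumes "rs \<in> set (subseqs xs)" and "p < length rs"
  shows "rs ! p \<in> set xs"
  using list_emb_set[of "(=)" rs xs] assms nth_mem by fastforce

lemma minor_form_of_degree:
  assumes "f \<in> minors k R C psi_matrix"
  shows "form_of_degree (length us) (length vs) k f"
  using assms unfolding minors_def psi_matrix_eq
  by (auto intro!: form_of_degree_det form_of_degree_linear_form)

lemma principal_pfaffian_form_of_degree: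
  assumes "f \<in> principal_pfaffians k R psi_skew_matrix"
  shows "form_of_degree (length us) (length vs) (k div 2) f"
  using assms unfolding principal_pfaffians_def psi_skew_matrix_eq
  by (auto intro!: form_of_degree_pfaffian form_of_degree_linear_form)

text \<open>Evaluation turns the minor into the determinant of a matrix that factors through fewer
  than \<open>k\<close> indices.\<close>

lemma minor_vanishes:
  assumes u: "\<And>i. i < r \<Longrightarrow> u i \<in> U_dual" and v: "\<And>i. i < r \<Longrightarrow> v i \<in> V_dual"
    and k: "r * ((length us - 1) choose j) < k"
    and f: "f \<in> minors k (psi_labels (length us) (length vs) (Suc j))
      (psi_labels (length us) (length vs) j) psi_matrix"
  shows "poly_eval f (coords (tensor_sum r u v)) = 0"
proof -
  let ?x = "tensor_sum r u v" and ?n = "length vs"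
  interpret ev: comm_ring_hom "\<lambda>p. poly_eval p (coords ?x)"
    by (rule comm_ring_hom_poly_eval)
  obtain rs cs where f_eq: "f = det (mat k k (\<lambda>(p, q). psi_matrix (rs ! p) (cs ! q)))"
    and rs: "rs \<in> set (subseqs (psi_labels (length us) ?n (Suc j)))" "length rs = k"
    and cs: "cs \<in> set (subseqs (psi_labels (length us) ?n j))" "length cs = k"
    using f unfolding minors_def by blast
  obtain I :: "(nat \<times> nat list) set" and A B where I: "finite I" "card I \<le> r * ((length us - 1) choose j)"
    and AB: "\<And>S T b a R. subseq T [0..<length us] \<Longrightarrow> length R = j \<Longrightarrow>
      psi_entry S T b (a, R) ?x = (\<Sum>t\<in>I. A S T b t * B t (a, R))"
    using u v by (rule psi_entry_factor[where j = j]) (assumption | rule that)+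
  have "poly_eval (psi_matrix (rs ! p) (cs ! q)) (coords ?x) =
      (\<Sum>t\<in>I. A [] (snd (rs ! p)) (fst (rs ! p)) t * B t (cs ! q))" if "p < k" "q < k" for p q
  proof -
    have "subseq (snd (rs ! p)) [0..<length us]" "length (snd (cs ! q)) = j"
      using psi_labelsD(1)[OF subseqs_nth[OF rs(1), of p]] psi_labelsD(2)[OF subseqs_nth[OF cs(1), of q]]
        rs(2) cs(2) that by simp_all
    then have "psi_entry [] (snd (rs ! p)) (fst (rs ! p)) (fst (cs ! q), snd (cs ! q)) ?x =
        (\<Sum>t\<in>I. A [] (snd (rs ! p)) (fst (rs ! p)) t * B t (fst (cs ! q), snd (cs ! q)))"
      by (rule AB)
    then show ?thesis
      unfolding psi_matrix_eq by (simp add: poly_eval_psi_entry u v)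
  qed
  then have "map_mat (\<lambda>p. poly_eval p (coords ?x)) (mat k k (\<lambda>(p, q). psi_matrix (rs ! p) (cs ! q))) =
      mat k k (\<lambda>(p, q). \<Sum>t\<in>I. A [] (snd (rs ! p)) (fst (rs ! p)) t * B t (cs ! q))"
    by (intro eq_matI) auto
  moreover have "det (mat k k (\<lambda>(p, q). \<Sum>t\<in>I. A [] (snd (rs ! p)) (fst (rs ! p)) t * B t (cs ! q))) = 0"
    using I k by (intro det_factor_eq_0) auto
  ultimately show ?thesis
    unfolding f_eq ev.hom_det[symmetric] by simp
qed

text \<open>For lists of equal length \<open>j\<close> the exponent in
  \<open>wedge_list_swap\<close> is \<open>2 * j + j * j\<close>, odd for odd \<open>j\<close>; the
  factors from \<open>v\<close> are symmetric.\<close>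

lemma psi_entry_skew:
  assumes v: "\<And>i. i < r \<Longrightarrow> v i \<in> V_dual" and "odd (length S)" and "length R = length S"
  shows "psi_entry R T a (b, S) (tensor_sum r u v) = - psi_entry S T b (a, R) (tensor_sum r u v)"
proof -
  have "wedge_list R (wedge w (wedge_list S unit_form)) l =
      - wedge_list S (wedge w (wedge_list R unit_form)) l" for w l
    using assms(2,3) by (subst wedge_list_swap) simp
  then show ?thesis
    using v by (simp add: psi_entry_tensor_sum sum_negf ac_simps)
qed

text \<open>The rank bound makes the evaluated principal submatrix singular, and a singular
  skew-symmetric matrix has zero Pfaffian.\<close>

lemma principal_pfaffian_vanishes:
  assumes u: "\<And>i. i < r \<Longrightarrow> u i \<in> U_dual" and v: "\<And>i. i < r \<Longrightarrow> v i \<in> V_dual"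
    and j: "odd j" and k: "r * ((length us - 1) choose j) < 2 * k"
    and f: "f \<in> principal_pfaffians (2 * k) (psi_labels (length us) (length vs) j) psi_skew_matrix"
  shows "poly_eval f (coords (tensor_sum r u v)) = 0"
proof -
  let ?x = "tensor_sum r u v"
  interpret ev: comm_ring_hom "\<lambda>p. poly_eval p (coords ?x)"
    by (rule comm_ring_hom_poly_eval)
  obtain rs where f_eq: "f = pfaffian k (\<lambda>p q. psi_skew_matrix (rs ! p) (rs ! q))"
    and rs: "rs \<in> set (subseqs (psi_labels (length us) (length vs) j))" "length rs = 2 * k"
    using f unfolding principal_pfaffians_def by auto
  obtain I :: "(nat \<times> nat list) set" and A B where I: "finite I" "card I \<le> r * ((length us - 1) choose j)"
    and AB: "\<And>S T b a R. subseq T [0..<length us] \<Longrightarrow> length R = j \<Longrightarrow>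
      psi_entry S T b (a, R) ?x = (\<Sum>t\<in>I. A S T b t * B t (a, R))"
    using u v by (rule psi_entry_factor[where j = j]) (assumption | rule that)+
  define K where "K p q = psi_entry (snd (rs ! p)) [0..<length us] (fst (rs ! p)) (rs ! q) ?x" for p q
  have len: "length (snd (rs ! p)) = j" if "p < 2 * k" for p
    using psi_labelsD(2)[OF subseqs_nth[OF rs(1), of p]] rs(2) that by simp
  have skew: "K q p = - K p q" if "p < 2 * k" "q < 2 * k" for p q
  proof -
    have "psi_entry (snd (rs ! q)) [0..<length us] (fst (rs ! q)) (fst (rs ! p), snd (rs ! p)) ?x =
        - psi_entry (snd (rs ! p)) [0..<length us] (fst (rs ! p)) (fst (rs ! q), snd (rs ! q)) ?x"
      by (rule psi_entry_skew) (use v len that j in simp_all)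
    then show ?thesis
      by (simp add: K_def)
  qed
  have "K p q = (\<Sum>t\<in>I. A (snd (rs ! p)) [0..<length us] (fst (rs ! p)) t * B t (rs ! q))"
    if "q < 2 * k" for p q
    using AB[of "[0..<length us]" "snd (rs ! q)" "snd (rs ! p)" "fst (rs ! p)" "fst (rs ! q)"]
      len[OF that] by (simp add: K_def)
  then have "mat (2 * k) (2 * k) (\<lambda>(p, q). K p q) = mat (2 * k) (2 * k)
      (\<lambda>(p, q). \<Sum>t\<in>I. A (snd (rs ! p)) [0..<length us] (fst (rs ! p)) t * B t (rs ! q))"
    by (intro eq_matI) auto
  moreover have "det (mat (2 * k) (2 * k)
      (\<lambda>(p, q). \<Sum>t\<in>I. A (snd (rs ! p)) [0..<length us] (fst (rs ! p)) t * B t (rs ! q))) = 0"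
    using I k by (intro det_factor_eq_0) auto
  ultimately have "pf_sum k K = 0"
    by (intro pf_sum_skew_eq_0[OF skew]) auto
  moreover have "poly_eval (psi_skew_matrix (rs ! p) (rs ! q)) (coords ?x) = K p q" for p q
    unfolding psi_skew_matrix_eq K_def by (rule poly_eval_psi_entry) (rule u v; assumption)+
  ultimately show ?thesis
    by (simp add: f_eq pfaffian_def pf_sum_def poly_eval_mult poly_eval_sum ev.hom_prod ev.hom_of_int)
qed

section \<open>Passage to the Zariski closure and to ideals\<close>

lemma affine_cone_sum:
  assumes "\<And>i. i < r \<Longrightarrow> y i \<in> affine_cone segre_veronese"
  obtains u v where "\<And>i. i < r \<Longrightarrow> u i \<in> U_dual" and "\<And>i. i < r \<Longrightarrow> v i \<in> V_dual"
    and "(\<lambda>p q s. \<Sum>i<r. y i p q s) = tensor_sum r u v"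
proof -
  have "\<exists>u v. y i = tensor u v v \<and> u \<in> U_dual \<and> v \<in> V_dual" if "i < r" for i
    using assms[OF that] unfolding affine_cone_segre_veronese by blast
  then obtain u v where uv: "y i = tensor (u i) (v i) (v i)" "u i \<in> U_dual" "v i \<in> V_dual" if "i < r" for i
    by metis
  show thesis
    by (rule that[of u v]) (use uv in \<open>simp_all add: tensor_sum_def\<close>)
qed

lemma U_dual_scale: "u \<in> U_dual \<Longrightarrow> (\<lambda>p. c * u p) \<in> U_dual"
  by (simp add: U_dual_def Vector_Spaces.linear_iff distrib_left mult.left_commute)

lemma vanishes_on_secant_variety:
  assumes f: "form_of_degree (length us) (length vs) d f"
    and zero: "\<And>u v. (\<And>i. i < r \<Longrightarrow> u i \<in> U_dual) \<Longrightarrow> (\<And>i. i < r \<Longrightarrow> v i \<in> V_dual) \<Longrightarrow>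
      poly_eval f (coords (tensor_sum r u v)) = 0"
  shows "f \<in> vanishing_ideal (secant_variety r segre_veronese)"
proof -
  let ?Z = "{line x | x y. x \<noteq> (\<lambda>_ _ _. 0) \<and> (\<forall>i<r. y i \<in> affine_cone segre_veronese) \<and>
        x = (\<lambda>p q s. \<Sum>i<r. y i p q s)}"
  have "vanishes_at f P" if "P \<in> ?Z" for P
    unfolding vanishes_at_def
  proof
    fix z assume z: "z \<in> P - {\<lambda>_ _ _. 0}"
    from that obtain x y where P: "P = line x" and y: "\<And>i. i < r \<Longrightarrow> y i \<in> affine_cone segre_veronese"
      and x: "x = (\<lambda>p q s. \<Sum>i<r. y i p q s)"
      by blast
    obtain u v where u: "\<And>i. i < r \<Longrightarrow> u i \<in> U_dual" and v: "\<And>i. i < r \<Longrightarrow> v i \<in> V_dual"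
      and xuv: "x = tensor_sum r u v"
      using affine_cone_sum[of r y] y x by metis
    from z P obtain c where "z = (\<lambda>p q s. c * x p q s)"
      unfolding line_def by blast
    \<comment> \<open>The scalar is absorbed into the factors \<open>u i\<close>, so
      \<open>zero\<close> applies to every nonzero point of the line.\<close>
    then have "z = tensor_sum r (\<lambda>i p. c * u i p) v"
      by (simp add: xuv tensor_sum_def tensor_def sum_distrib_left mult.assoc)
    then show "poly_eval f (coords z) = 0"
      using zero[of "\<lambda>i p. c * u i p" v] U_dual_scale u v by simp
  qed
  then have "f \<in> hom_vanishing ?Z"
    using form_of_degreeD[OF f] by (simp add: hom_vanishing_def)
  \<comment> \<open>By definition, every homogeneous polynomial vanishing on a set also vanishes on
    its Zariski closure.\<close>
  then have "f \<in> hom_vanishing (secant_variety r segre_veronese)"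
    unfolding secant_variety_def zariski_closure_def hom_vanishing_def by blast
  moreover interpret R: cring "coord_ring (length us) (length vs)"
    by (rule cring_coord_ring)
  have "hom_vanishing (secant_variety r segre_veronese) \<subseteq> carrier (coord_ring (length us) (length vs))"
    by (auto simp: hom_vanishing_def)
  ultimately show ?thesis
    unfolding vanishing_ideal_def using R.genideal_self by blast
qed

text \<open>Containment of subschemes reverses the inclusion of ideals. Since the target is an
  ideal, checking the generators is enough.\<close>

lemma I_kappa_subset_vanishing_ideal:
  assumes c: "\<And>j. j < length us \<Longrightarrow> c j = r * ((length us - 1) choose j)"
  shows "I_kappa c \<subseteq> vanishing_ideal (secant_variety r segre_veronese)"
proof -
  interpret R: cring "coord_ring (length us) (length vs)"
    by (rule cring_coord_ring)
  have ideal: "ideal (vanishing_ideal (secant_variety r segre_veronese))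
      (coord_ring (length us) (length vs))"
    unfolding vanishing_ideal_def by (rule R.genideal_ideal) (auto simp: hom_vanishing_def)
  have gen: "f \<in> vanishing_ideal (secant_variety r segre_veronese)"
    if j: "j < length us" and f: "f \<in> kappa_generators c j" for j f
  proof (cases "length us = 2 * j + 1 \<and> odd j \<and> even (c j)")
    case True
    \<comment> \<open>As \<open>c j\<close> is even, the Pfaffians have even size
      \<open>2 * k = c j + 2\<close>, above the rank bound \<open>c j\<close>.\<close>
    define k where "k = c j div 2 + 1"
    have k: "c j + 2 = 2 * k"
      using True by (simp add: k_def)
    have f': "f \<in> principal_pfaffians (2 * k) (psi_labels (length us) (length vs) j) psi_skew_matrix"
      using f True k by (simp add: kappa_generators_def Let_def)
    show ?thesis
    proof (rule vanishes_on_secant_variety[OF principal_pfaffian_form_of_degree[OF f']])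
      fix u v assume "\<And>i. i < r \<Longrightarrow> u i \<in> U_dual" "\<And>i. i < r \<Longrightarrow> v i \<in> V_dual"
      then show "poly_eval f (coords (tensor_sum r u v)) = 0"
        by (rule principal_pfaffian_vanishes[OF _ _ _ _ f']) (use True k c[OF j] in auto)
    qed
  next
    case False
    \<comment> \<open>The minors have size \<open>c j + 1\<close>, just above the rank
      bound.\<close>
    then have f': "f \<in> minors (Suc (c j)) (psi_labels (length us) (length vs) (Suc j))
        (psi_labels (length us) (length vs) j) psi_matrix"
      using f by (auto simp: kappa_generators_def Let_def split: if_splits)
    show ?thesis
    proof (rule vanishes_on_secant_variety[OF minor_form_of_degree[OF f']])
      fix u v assume "\<And>i. i < r \<Longrightarrow> u i \<in> U_dual" "\<And>i. i < r \<Longrightarrow> v i \<in> V_dual"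
      then show "poly_eval f (coords (tensor_sum r u v)) = 0"
        by (rule minor_vanishes[OF _ _ _ f']) (use c[OF j] in auto)
    qed
  qed
  have "I_kappa_at c j \<subseteq> vanishing_ideal (secant_variety r segre_veronese)" if "j < length us" for j
    unfolding I_kappa_at_def
    by (rule R.genideal_minimal[OF ideal], rule subsetI, rule gen[OF that])
  then show ?thesis
    unfolding I_kappa_def by (intro R.genideal_minimal[OF ideal] UN_least) simp
qed

end

text \<open>The ideals are already included before saturation, so monotonicity finishes the
  comparison of subschemes.\<close>

lemma saturation_mono: "I \<subseteq> J \<Longrightarrow> saturation m n I \<subseteq> saturation m n J"
  unfolding saturation_def by blast

theorem proposition3p3:
  fixes scaleU :: "complex \<Rightarrow> 'u::ab_group_add \<Rightarrow> 'u" and us :: "'u list"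
    and scaleV :: "complex \<Rightarrow> 'v::ab_group_add \<Rightarrow> 'v" and vs :: "'v list"
    and m n r :: nat and c :: "nat \<Rightarrow> nat"
  assumes bases: "based_spaces scaleU us scaleV vs"
    and dim_U: "vector_space.dim scaleU (UNIV :: 'u set) = m"
    and dim_V: "vector_space.dim scaleV (UNIV :: 'v set) = n"
    and r: "1 \<le> r"
    and c: "\<And>j. j < m \<Longrightarrow> c j = r * ((m - 1) choose j)"
  shows "subscheme_contained m n
    (based_spaces.vanishing_ideal us vs
      (based_spaces.secant_variety scaleU us scaleV vs r
        (based_spaces.segre_veronese scaleU scaleV)))
    (based_spaces.I_kappa scaleU us scaleV vs c)"
proof -
  interpret based_spaces scaleU us scaleV vs
    by (rule bases)
  \<comment> \<open>The distinct basis \<open>us\<close> has \<open>m\<close> elements, which puts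
    the formula for \<open>c\<close> in terms of \<open>length us\<close>.\<close>
  have "m = length us"
    using dim_U U.dim_UNIV distinct_card[OF distinct_us] by simp
  then show ?thesis
    unfolding subscheme_contained_def
    using c by (intro saturation_mono I_kappa_subset_vanishing_ideal) simp
qed

end
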